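(* Let $(S\times\mathbb{R},g)$ be a standard stationary spacetime with $S\setminus K$ ($K$ compact) a disjoint union of ends, satisfying in the asymptotic coordinates of each end $E^{(k)}$ $$(g_0)_{ij}-\delta_{ij}+|x|\partial_l(g_0)_{ij}=O(1/|x|^{p_0}),\quad (\omega_0)_j+|x|\partial_l(\omega_0)_j=O(1/|x|^{q_0}),\quad (\beta-1)+|x|\partial_l\beta=O(1/|x|^{q'}),$$ for some $p_0,q_0,q'>0$. Let $C>0$ be a constant and let $S^{n-1}(r_0)$ be the sphere of radius $r_0$ in $E^{(k)}$. Then: (1) if $q'\in(0,2q_0)$ and $\partial_r\beta\sim-\dfrac{C}{|x|^{q'+1}}$ as $|x|\to+\infty$, then the hypersurfaces $S^{n-1}(r_0)\times\mathbb{R}$ are strongly time-convex for any $r_0$ large enough; (2) if $\partial_r\beta\sim\dfrac{C}{|x|^{q'+1}}$ as $|x|\to+\infty$, then, for any $r_0$ large enough, the hypersurfaces $S^{n-1}(r_0)\times\mathbb{R}$ are (strongly light-convex but) not infinitesimally time-convex.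
   Context: Standard stationary spacetime: $S\times\mathbb{R}$, $\dim S=n$, with $g\big((y,\tau),(y,\tau)\big)=g_0(y,y)+2\omega_0(y)\tau-\beta(x)\tau^2$ for $(y,\tau)\in T_xS\times\mathbb{R}$, with $g_0$ a Riemannian metric, $\omega_0$ a one-form, $\beta>0$ a function on $S$. The ends $E^{(k)}$ are finitely many, each diffeomorphic to $\mathbb{R}^n\setminus\{0\}$ with an asymptotic chart $x=(x^1,\dots,x^n)$, $|x|^2=\sum_i(x^i)^2$, $\partial_r=\frac{x^i}{|x|}\partial_i$. The fall-off conditions mean that each summand on the left is separately of the indicated order as $|x|\to\infty$, for all indices. $S^{n-1}(r_0)$ is the sphere $|x|^2=r_0^2$, regarded as the boundary of $|x|^2<r_0^2$. With $\Phi(x,t)=r_0^2-|x|^2$ and $H^{g}_\Phi$ the Hessian for the Levi-Civita connection of $g$, $S^{n-1}(r_0)\times\mathbb{R}$ is infinitesimally time-convex if $H^{g}_\Phi(v,v)\le0$ for every timelike $v$ tangent to it, and strongly time-convex (resp. strongly light-convex) if $H^{g}_\Phi(v,v)<0$ for every timelike (resp. lightlike) $v$ tangent to it. *)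

theory Defs
  imports "HOL-Analysis.Analysis" "HOL-Library.Landau_Symbols"
begin

section \<open>Smooth manifolds and tensor fields in charts\<close>

abbreviation dir_deriv ::
    "('m::euclidean_space \<Rightarrow> 'b::real_normed_vector) \<Rightarrow> 'm \<Rightarrow> 'm \<Rightarrow> 'b"
  where "dir_deriv f v x \<equiv> frechet_derivative f (at x) v"

text \<open>\<open>Ck_on k U f\<close> is only meant for open \<open>U\<close>.\<close>

primrec Ck_on ::
    "nat \<Rightarrow> 'm::euclidean_space set \<Rightarrow> ('m \<Rightarrow> 'b::real_normed_vector) \<Rightarrow> bool"
  where
    "Ck_on 0 U f \<longleftrightarrow> continuous_on U f"
  | "Ck_on (Suc k) U f \<longleftrightarrow>
       (\<forall>x\<in>U. f differentiable (at x)) \<and> (\<forall>v. Ck_on k U (dir_deriv f v))"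

definition smooth_on :: "'m::euclidean_space set \<Rightarrow> ('m \<Rightarrow> 'b::real_normed_vector) \<Rightarrow> bool"
  where "smooth_on U f \<longleftrightarrow> (\<forall>k. Ck_on k U f)"

text \<open>A chart is a pair of a domain and a coordinate map (with irrelevant values outside the
  domain).\<close>

type_synonym ('a, 'm) chart = "'a set \<times> ('a \<Rightarrow> 'm)"

abbreviation chart_image :: "('a, 'm) chart \<Rightarrow> 'm set"
  where "chart_image c \<equiv> snd c ` fst c"

definition chart_inv :: "('a, 'm) chart \<Rightarrow> 'm \<Rightarrow> 'a"
  where "chart_inv c = inv_into (fst c) (snd c)"

definition transition :: "('a, 'm) chart \<Rightarrow> ('a, 'm) chart \<Rightarrow> 'm \<Rightarrow> 'm"
  where "transition c d = snd d \<circ> chart_inv c"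

text \<open>Maximality of the atlas is not required; the maximal atlas of a manifold is one instance.\<close>

definition smooth_manifold :: "'a topology \<Rightarrow> ('a, 'm::euclidean_space) chart set \<Rightarrow> bool"
  where "smooth_manifold S A \<longleftrightarrow>
    Hausdorff_space S \<and> second_countable S \<and>
    (\<Union>c\<in>A. fst c) = topspace S \<and>
    (\<forall>c\<in>A. openin S (fst c) \<and> open (chart_image c) \<and>
       homeomorphic_map (subtopology S (fst c)) (top_of_set (chart_image c)) (snd c)) \<and>
    (\<forall>c\<in>A. \<forall>d\<in>A. smooth_on (snd c ` (fst c \<inter> fst d)) (transition c d))"

definition smooth_function ::
    "('a, 'm::euclidean_space) chart set \<Rightarrow> ('a \<Rightarrow> real) \<Rightarrow> bool"
  where "smooth_function A f \<longleftrightarrow> (\<forall>c\<in>A. smooth_on (chart_image c) (f \<circ> chart_inv c))"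

text \<open>Covariant tensor fields are given by their expressions in the charts of the atlas, as
  functions of the coordinates, subject to the usual transformation law.\<close>

definition one_form ::
    "('a, 'm::euclidean_space) chart set \<Rightarrow> (('a, 'm) chart \<Rightarrow> 'm \<Rightarrow> 'm \<Rightarrow> real) \<Rightarrow> bool"
  where "one_form A \<omega> \<longleftrightarrow>
    (\<forall>c\<in>A. \<forall>x\<in>chart_image c. linear (\<omega> c x)) \<and>
    (\<forall>c\<in>A. \<forall>v. smooth_on (chart_image c) (\<lambda>x. \<omega> c x v)) \<and>
    (\<forall>c\<in>A. \<forall>d\<in>A. \<forall>p\<in>fst c \<inter> fst d. \<forall>v.
       \<omega> c (snd c p) v = \<omega> d (snd d p) (dir_deriv (transition c d) v (snd c p)))"

definition riemannian_metric ::
    "('a, 'm::euclidean_space) chart set \<Rightarrow>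
     (('a, 'm) chart \<Rightarrow> 'm \<Rightarrow> 'm \<Rightarrow> 'm \<Rightarrow> real) \<Rightarrow> bool"
  where "riemannian_metric A g \<longleftrightarrow>
    (\<forall>c\<in>A. \<forall>x\<in>chart_image c. bilinear (g c x) \<and>
       (\<forall>v w. g c x v w = g c x w v) \<and> (\<forall>v. v \<noteq> 0 \<longrightarrow> g c x v v > 0)) \<and>
    (\<forall>c\<in>A. \<forall>v w. smooth_on (chart_image c) (\<lambda>x. g c x v w)) \<and>
    (\<forall>c\<in>A. \<forall>d\<in>A. \<forall>p\<in>fst c \<inter> fst d. \<forall>v w.
       g c (snd c p) v w =
         g d (snd d p) (dir_deriv (transition c d) v (snd c p))
                       (dir_deriv (transition c d) w (snd c p)))"

section \<open>Levi-Civita connection and Hessian in a chart\<close>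

text \<open>Let \<open>g\<close> be a semi-Riemannian metric on an open set of coordinates.  The connection of a
  chart is given at \<open>x\<close> by the bilinear map \<open>G\<close> with
  \<open>\<nabla>\<^sub>X Y = dir_deriv Y X + G X Y\<close> at \<open>x\<close>; symmetry of \<open>G\<close> says that \<open>\<nabla>\<close> is
  torsion-free, the last condition says that \<open>\<nabla>g = 0\<close>.  The entries of \<open>G\<close> are the Christoffel
  symbols.\<close>

definition is_levi_civita_at ::
    "('m::euclidean_space \<Rightarrow> 'm \<Rightarrow> 'm \<Rightarrow> real) \<Rightarrow> 'm \<Rightarrow> ('m \<Rightarrow> 'm \<Rightarrow> 'm) \<Rightarrow> bool"
  where "is_levi_civita_at g x G \<longleftrightarrow>
    bilinear G \<and> (\<forall>u v. G u v = G v u) \<and>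
    (\<forall>u v w. dir_deriv (\<lambda>y. g y v w) u x = g x (G u v) w + g x v (G u w))"

definition levi_civita ::
    "('m::euclidean_space \<Rightarrow> 'm \<Rightarrow> 'm \<Rightarrow> real) \<Rightarrow> 'm \<Rightarrow> 'm \<Rightarrow> 'm \<Rightarrow> 'm"
  where "levi_civita g x = (THE G. is_levi_civita_at g x G)"

text \<open>\<open>H\<^sub>\<Phi>(X, Y) = X (Y \<Phi>) - (\<nabla>\<^sub>X Y) \<Phi>\<close>, evaluated on the constant coordinate fields
  \<open>v\<close> and \<open>w\<close>.\<close>

definition hessian ::
    "('m::euclidean_space \<Rightarrow> 'm \<Rightarrow> 'm \<Rightarrow> real) \<Rightarrow> ('m \<Rightarrow> real) \<Rightarrow> 'm \<Rightarrow> 'm \<Rightarrow> 'm \<Rightarrow> real"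
  where "hessian g \<Phi> x v w =
    dir_deriv (dir_deriv \<Phi> w) v x - dir_deriv \<Phi> (levi_civita g x v w) x"

text \<open>The description in \<^const>\<open>levi_civita\<close> is proper: fundamental theorem of Riemannian
  geometry at a point.\<close>

lemma nondegenerate_represents:
  fixes B :: "'m::euclidean_space \<Rightarrow> 'm \<Rightarrow> real"
  assumes B: "bilinear B" and nd: "\<And>v. (\<forall>w. B v w = 0) \<Longrightarrow> v = 0" and L: "linear L"
  shows "\<exists>z. \<forall>w. B z w = L w"
proof -
  have lin2: "linear (B z)" for z using B by (simp add: bilinear_def)
  define f where "f z = (\<Sum>b\<in>Basis. B z b *\<^sub>R b)" for z
  have fb: "f z \<bullet> b = B z b" if "b \<in> Basis" for z b
    using that by (simp add: f_def)
  have linf: "linear f"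
    by (rule linearI) (simp_all add: f_def bilinear_ladd[OF B] bilinear_lmul[OF B]
        scaleR_add_left sum.distrib scaleR_sum_right)
  have "inj f"
  proof (subst linear_injective_0[OF linf], intro allI impI)
    fix z assume "f z = 0"
    then have "B z b = 0" if "b \<in> Basis" for b using fb[OF that, of z] by simp
    then have "B z w = 0" for w
      using linear_eq_stdbasis[OF lin2[of z] module_hom_zero] by metis
    then show "z = 0" using nd by blast
  qed
  then have "surj f" by (simp add: linear_injective_imp_surjective[OF linf])
  then obtain z where z: "f z = (\<Sum>b\<in>Basis. L b *\<^sub>R b)" by (metis surjD)
  have "B z b = L b" if "b \<in> Basis" for b
    using fb[OF that, of z] that by (simp add: z)
  then have "B z = L" using linear_eq_stdbasis[OF lin2 L] by blast
  then show ?thesis by auto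
qed

lemma ex1_levi_civita_at:
  fixes g :: "'m::euclidean_space \<Rightarrow> 'm \<Rightarrow> 'm \<Rightarrow> real"
  assumes bil: "bilinear (g x)" and sym: "\<And>v w. g x v w = g x w v"
    and nd: "\<And>v. (\<forall>w. g x v w = 0) \<Longrightarrow> v = 0"
    and D: "\<And>v w. linear (\<lambda>u. dir_deriv (\<lambda>y. g y v w) u x)"
      "\<And>u. bilinear (\<lambda>v w. dir_deriv (\<lambda>y. g y v w) u x)"
      "\<And>u v w. dir_deriv (\<lambda>y. g y v w) u x = dir_deriv (\<lambda>y. g y w v) u x"
  shows "\<exists>!G. is_levi_civita_at g x G"
proof -
  define T where "T u v w = dir_deriv (\<lambda>y. g y v w) u x" for u v w
  have T1: "linear (\<lambda>u. T u v w)" for v w using D(1) by (simp add: T_def)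
  have T2: "linear (\<lambda>v. T u v w)" and T3: "linear (\<lambda>w. T u v w)" for u v w
    using D(2) by (simp_all add: bilinear_def T_def)
  have Ts: "T u v w = T u w v" for u v w using D(3) by (simp add: T_def)
  define k where "k u v w = (T u v w + T v u w - T w u v) / 2" for u v w
  have lk: "linear (\<lambda>u. k u v w)" "linear (\<lambda>v. k u v w)" "linear (\<lambda>w. k u v w)" for u v w
    unfolding k_def
    by (rule linearI;
        simp add: linear_add[OF T1] linear_add[OF T2] linear_add[OF T3] linear_cmul[OF T1]
        linear_cmul[OF T2] linear_cmul[OF T3] field_simps)+
  have kE: "\<exists>z. \<forall>w. g x z w = k u v w" for u v
    by (rule nondegenerate_represents[OF bil nd lk(3)])
  have unique: "z = z'" if "\<And>w. g x z w = g x z' w" for z z'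
    using nd[of "z - z'"] that by (simp add: bilinear_lsub[OF bil])
  from kE obtain G where G: "\<And>u v w. g x (G u v) w = k u v w" by metis
  have "bilinear G"
    unfolding bilinear_def
    by (intro conjI allI linearI; rule unique;
        simp add: G bilinear_ladd[OF bil] bilinear_lmul[OF bil] linear_add[OF lk(1)]
        linear_add[OF lk(2)] linear_cmul[OF lk(1)] linear_cmul[OF lk(2)])
  moreover have "G u v = G v u" for u v
    by (rule unique) (simp add: G k_def Ts[of _ u v])
  moreover have "T u v w = g x (G u v) w + g x v (G u w)" for u v w
    using G[of u v w] G[of u w v] sym[of v "G u w"] Ts[of u w v] Ts[of v u w] Ts[of w u v]
    by (simp add: k_def field_simps)
  ultimately have ex: "is_levi_civita_at g x G" by (simp add: is_levi_civita_at_def T_def)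
  have "H = G" if "is_levi_civita_at g x H" for H
  proof (intro ext unique)
    fix u v w
    have s: "H a b = H b a" and c: "T a b d = g x (H a b) d + g x b (H a d)" for a b d
      using that by (simp_all add: is_levi_civita_at_def T_def)
    have "2 * g x (H u v) w = T u v w + T v u w - T w u v"
      using c[of u v w] c[of v u w] c[of w u v] s[of u v] s[of u w] s[of v w]
        sym[of v "H u w"] sym[of u "H v w"] sym[of w "H u v"]
      by simp
    then show "g x (H u v) w = g x (G u v) w" by (simp add: G k_def)
  qed
  with ex show ?thesis by blast
qed

section \<open>Convexity of hypersurfaces\<close>

text \<open>In the following, \<open>g\<close> is a Lorentzian metric in a chart and the hypersurface \<open>M\<close>
  is a level set of \<open>\<Phi>\<close>, with \<open>\<Phi> > 0\<close> on the side that it bounds.\<close>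

definition tangent_vectors :: "'m::euclidean_space set \<Rightarrow> 'm \<Rightarrow> 'm set"
  where "tangent_vectors M z =
    {v. \<exists>\<gamma> :: real \<Rightarrow> 'm. \<gamma> 0 = z \<and> (\<forall>\<^sub>F s in nhds 0. \<gamma> s \<in> M) \<and>
        (\<gamma> has_vector_derivative v) (at 0)}"

definition timelike :: "('m \<Rightarrow> 'm \<Rightarrow> 'm \<Rightarrow> real) \<Rightarrow> 'm \<Rightarrow> 'm \<Rightarrow> bool"
  where "timelike g z v \<longleftrightarrow> g z v v < 0"

definition lightlike :: "('m::zero \<Rightarrow> 'm \<Rightarrow> 'm \<Rightarrow> real) \<Rightarrow> 'm \<Rightarrow> 'm \<Rightarrow> bool"
  where "lightlike g z v \<longleftrightarrow> v \<noteq> 0 \<and> g z v v = 0"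

definition infinitesimally_time_convex ::
    "('m::euclidean_space \<Rightarrow> 'm \<Rightarrow> 'm \<Rightarrow> real) \<Rightarrow> ('m \<Rightarrow> real) \<Rightarrow> 'm set \<Rightarrow> bool"
  where "infinitesimally_time_convex g \<Phi> M \<longleftrightarrow>
    (\<forall>z\<in>M. \<forall>v\<in>tangent_vectors M z. timelike g z v \<longrightarrow> hessian g \<Phi> z v v \<le> 0)"

definition strongly_time_convex ::
    "('m::euclidean_space \<Rightarrow> 'm \<Rightarrow> 'm \<Rightarrow> real) \<Rightarrow> ('m \<Rightarrow> real) \<Rightarrow> 'm set \<Rightarrow> bool"
  where "strongly_time_convex g \<Phi> M \<longleftrightarrow>
    (\<forall>z\<in>M. \<forall>v\<in>tangent_vectors M z. timelike g z v \<longrightarrow> hessian g \<Phi> z v v < 0)"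

definition strongly_light_convex ::
    "('m::euclidean_space \<Rightarrow> 'm \<Rightarrow> 'm \<Rightarrow> real) \<Rightarrow> ('m \<Rightarrow> real) \<Rightarrow> 'm set \<Rightarrow> bool"
  where "strongly_light_convex g \<Phi> M \<longleftrightarrow>
    (\<forall>z\<in>M. \<forall>v\<in>tangent_vectors M z. lightlike g z v \<longrightarrow> hessian g \<Phi> z v v < 0)"

section \<open>Standard stationary spacetimes with asymptotic ends\<close>

definition standard_stationary ::
    "'a topology \<Rightarrow> ('a, 'm::euclidean_space) chart set \<Rightarrow>
     (('a, 'm) chart \<Rightarrow> 'm \<Rightarrow> 'm \<Rightarrow> 'm \<Rightarrow> real) \<Rightarrow>
     (('a, 'm) chart \<Rightarrow> 'm \<Rightarrow> 'm \<Rightarrow> real) \<Rightarrow> ('a \<Rightarrow> real) \<Rightarrow> bool"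
  where "standard_stationary S A g\<^sub>0 \<omega>\<^sub>0 \<beta> \<longleftrightarrow>
    smooth_manifold S A \<and> riemannian_metric A g\<^sub>0 \<and> one_form A \<omega>\<^sub>0 \<and>
    smooth_function A \<beta> \<and> (\<forall>p\<in>topspace S. \<beta> p > 0)"

text \<open>The metric on \<open>S \<times> \<real>\<close> in the product chart induced by the chart \<open>c\<close> of \<open>S\<close>: the
  polarization of the quadratic form \<open>g\<^sub>0(y,y) + 2 \<omega>\<^sub>0(y) \<tau> - \<beta> \<tau>\<^sup>2\<close>.\<close>

definition stationary_metric ::
    "(('a, 'm) chart \<Rightarrow> 'm \<Rightarrow> 'm \<Rightarrow> 'm \<Rightarrow> real) \<Rightarrow>
     (('a, 'm) chart \<Rightarrow> 'm \<Rightarrow> 'm \<Rightarrow> real) \<Rightarrow> ('a \<Rightarrow> real) \<Rightarrow>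
     ('a, 'm) chart \<Rightarrow> 'm \<times> real \<Rightarrow> 'm \<times> real \<Rightarrow> 'm \<times> real \<Rightarrow> real"
  where "stationary_metric g\<^sub>0 \<omega>\<^sub>0 \<beta> c = (\<lambda>(x, t) (y, \<tau>) (y', \<tau>').
    g\<^sub>0 c x y y' + \<omega>\<^sub>0 c x y * \<tau>' + \<omega>\<^sub>0 c x y' * \<tau> - \<beta> (chart_inv c x) * \<tau> * \<tau>')"

text \<open>\<open>EE\<close> is the set of asymptotic charts, one for each end.\<close>

definition asymptotic_ends ::
    "'a topology \<Rightarrow> ('a, real^'n) chart set \<Rightarrow> 'a set \<Rightarrow> ('a, real^'n) chart set \<Rightarrow> bool"
  where "asymptotic_ends S A K EE \<longleftrightarrow>
    compactin S K \<and> finite EE \<and> EE \<subseteq> A \<and>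
    (\<forall>c\<in>EE. chart_image c = UNIV - {0}) \<and>
    pairwise (\<lambda>c d. disjnt (fst c) (fst d)) EE \<and>
    topspace S - K = (\<Union>c\<in>EE. fst c)"

abbreviation pderiv_at :: "'n::finite \<Rightarrow> (real^'n \<Rightarrow> real) \<Rightarrow> real^'n \<Rightarrow> real"
  where "pderiv_at l f \<equiv> dir_deriv f (axis l 1)"

definition radial_deriv :: "(real^'n::finite \<Rightarrow> real) \<Rightarrow> real^'n \<Rightarrow> real"
  where "radial_deriv f x = (\<Sum>i\<in>UNIV. x $ i / norm x * pderiv_at i f x)"

definition fall_off ::
    "(('a, real^'n::finite) chart \<Rightarrow> real^'n \<Rightarrow> real^'n \<Rightarrow> real^'n \<Rightarrow> real) \<Rightarrow>
     (('a, real^'n) chart \<Rightarrow> real^'n \<Rightarrow> real^'n \<Rightarrow> real) \<Rightarrow> ('a \<Rightarrow> real) \<Rightarrow>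
     real \<Rightarrow> real \<Rightarrow> real \<Rightarrow> ('a, real^'n) chart \<Rightarrow> bool"
  where "fall_off g\<^sub>0 \<omega>\<^sub>0 \<beta> p\<^sub>0 q\<^sub>0 q' c \<longleftrightarrow>
    (let gg = (\<lambda>i j x. g\<^sub>0 c x (axis i 1) (axis j 1));
         ww = (\<lambda>j x. \<omega>\<^sub>0 c x (axis j 1));
         bb = \<beta> \<circ> chart_inv c
     in
      (\<forall>i j. (\<lambda>x. gg i j x - (if i = j then 1 else 0)) \<in> O[at_infinity](\<lambda>x. 1 / norm x powr p\<^sub>0)) \<and>
      (\<forall>i j l. (\<lambda>x. norm x * pderiv_at l (gg i j) x) \<in> O[at_infinity](\<lambda>x. 1 / norm x powr p\<^sub>0)) \<and>
      (\<forall>j. ww j \<in> O[at_infinity](\<lambda>x. 1 / norm x powr q\<^sub>0)) \<and>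
      (\<forall>j l. (\<lambda>x. norm x * pderiv_at l (ww j) x) \<in> O[at_infinity](\<lambda>x. 1 / norm x powr q\<^sub>0)) \<and>
      (\<lambda>x. bb x - 1) \<in> O[at_infinity](\<lambda>x. 1 / norm x powr q') \<and>
      (\<forall>l. (\<lambda>x. norm x * pderiv_at l bb x) \<in> O[at_infinity](\<lambda>x. 1 / norm x powr q')))"

text \<open>\<open>S\<^sup>n\<^sup>-\<^sup>1(r\<^sub>0) \<times> \<real>\<close> in the product coordinates of an end, and its defining function.\<close>

definition cylinder :: "real \<Rightarrow> ((real^'n::finite) \<times> real) set"
  where "cylinder r\<^sub>0 = {x. norm x = r\<^sub>0} \<times> UNIV"

definition cylinder_fun :: "real \<Rightarrow> (real^'n::finite) \<times> real \<Rightarrow> real"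
  where "cylinder_fun r\<^sub>0 = (\<lambda>(x, t). r\<^sub>0\<^sup>2 - (norm x)\<^sup>2)"

end

theory Submission
  imports Defs
begin

text \<open>Write \<open>x\<close> for the coordinates of the end, \<open>r = |x|\<close>, and let \<open>v = (y, \<tau>)\<close>.  Let \<open>w = (a, b)\<close> be
  the negative gradient of \<open>\<Phi>\<close>, that is \<open>g w (z, \<sigma>) = 2 (x \<bullet> z)\<close>.  Koszul's formula turns the Hessian into
  \<open>H v v = - 2 |y|\<^sup>2 + D\<^sub>v g (v, w) - 1/2 D\<^sub>w g (v, v)\<close>, where the derivatives act on the
  coefficients of \<open>g\<close> only (\<open>hessian_via_gradient\<close>), so that no Christoffel symbol of the
  stationary metric has to be computed.  The equations for \<open>w\<close> give \<open>b = \<omega>\<^sub>0 a / \<beta>\<close> and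
  \<open>a = 2 x + o(r)\<close>.  Hence
  \<open>H v v = - (2 + o(1)) |y|\<^sup>2 + O(r\<^sup>-\<^sup>q) |y| |\<tau>| + (r \<partial>\<^sub>r \<beta> + o(r\<^sup>-\<^sup>p)) \<tau>\<^sup>2\<close>
  with \<open>q = q\<^sub>0\<close> and \<open>p = q'\<close> (\<open>hessian_estimate\<close> pointwise, \<open>hessian_asymptotics\<close> in the limit).

  If \<open>r \<partial>\<^sub>r \<beta>\<close> is asymptotic to \<open>- C r\<^sup>-\<^sup>p\<close> and \<open>p < 2 q\<close>, the discriminant of this quadratic form
  in \<open>(|y|, |\<tau>|)\<close> is negative for large \<open>r\<close>, so the form is negative definite.  On lightlike vectors
  \<open>|\<tau>|\<close> is at most \<open>3 |y|\<close> for large \<open>r\<close>, and the first term dominates.  If \<open>r \<partial>\<^sub>r \<beta>\<close> is asymptotic to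
  \<open>C r\<^sup>-\<^sup>p\<close>, the Hessian is positive on the timelike tangent vector \<open>(0, 1)\<close>.\<close>

section \<open>The Hessian through the gradient\<close>

lemma frechet_derivative_eqI:
  "(f has_derivative F) (at x) \<Longrightarrow> dir_deriv f v x = F v"
  by (metis frechet_derivative_at)

lemma linear_dir_deriv:
  assumes "f differentiable (at x)"
  shows "linear (\<lambda>u. dir_deriv f u x)"
  using linear_frechet_derivative[OF assms] by (simp add: eta_contract_eq)

lemma linear_dir_deriv_parameter:
  fixes f :: "'m::euclidean_space \<Rightarrow> 'v::real_vector \<Rightarrow> real"
  assumes U: "open U" "x \<in> U" and lin: "\<And>y. y \<in> U \<Longrightarrow> linear (f y)"
    and diff: "\<And>v. (\<lambda>y. f y v) differentiable (at x)"
  shows "linear (\<lambda>v. dir_deriv (\<lambda>y. f y v) u x)"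
proof (rule linearI)
  have D: "((\<lambda>y. f y v) has_derivative (\<lambda>u. dir_deriv (\<lambda>y. f y v) u x)) (at x)" for v
    using diff[of v] frechet_derivative_works by blast
  fix v w :: 'v and k :: real
  have "((\<lambda>y. f y (v + w)) has_derivative
      (\<lambda>u. dir_deriv (\<lambda>y. f y v) u x + dir_deriv (\<lambda>y. f y w) u x)) (at x)"
    by (rule has_derivative_transform_within_open[OF has_derivative_add[OF D D] U])
      (simp add: linear_add[OF lin])
  then show "dir_deriv (\<lambda>y. f y (v + w)) u x = dir_deriv (\<lambda>y. f y v) u x + dir_deriv (\<lambda>y. f y w) u x"
    by (rule frechet_derivative_eqI)
  have "((\<lambda>y. f y (k *\<^sub>R v)) has_derivative
      (\<lambda>u. k *\<^sub>R dir_deriv (\<lambda>y. f y v) u x)) (at x)"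
    by (rule has_derivative_transform_within_open[OF has_derivative_scaleR_right[OF D] U])
      (simp add: linear_cmul[OF lin])
  then show "dir_deriv (\<lambda>y. f y (k *\<^sub>R v)) u x = k *\<^sub>R dir_deriv (\<lambda>y. f y v) u x"
    by (rule frechet_derivative_eqI)
qed

lemma bilinear_dir_deriv_parameter:
  fixes g :: "'m::euclidean_space \<Rightarrow> 'v::real_vector \<Rightarrow> 'v \<Rightarrow> real"
  assumes U: "open U" "x \<in> U" and bil: "\<And>y. y \<in> U \<Longrightarrow> bilinear (g y)"
    and diff: "\<And>v w. (\<lambda>y. g y v w) differentiable (at x)"
  shows "bilinear (\<lambda>v w. dir_deriv (\<lambda>y. g y v w) u x)"
  unfolding bilinear_def
proof (intro conjI allI)
  show "linear (\<lambda>w. dir_deriv (\<lambda>y. g y v w) u x)" for v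
    by (rule linear_dir_deriv_parameter[OF U])
      (use bil diff in \<open>auto simp: bilinear_def\<close>)
  show "linear (\<lambda>v. dir_deriv (\<lambda>y. g y v w) u x)" for w
    by (rule linear_dir_deriv_parameter[OF U, where f = "\<lambda>y v. g y v w"])
      (use bil diff in \<open>auto simp: bilinear_def\<close>)
qed

lemma is_levi_civita_at_levi_civita:
  fixes g :: "'m::euclidean_space \<Rightarrow> 'm \<Rightarrow> 'm \<Rightarrow> real"
  assumes U: "open U" "x \<in> U" and bil: "\<And>y. y \<in> U \<Longrightarrow> bilinear (g y)"
    and sym: "\<And>y v w. y \<in> U \<Longrightarrow> g y v w = g y w v"
    and nd: "\<And>v. (\<forall>w. g x v w = 0) \<Longrightarrow> v = 0"
    and diff: "\<And>v w. (\<lambda>y. g y v w) differentiable (at x)"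
  shows "is_levi_civita_at g x (levi_civita g x)"
  unfolding levi_civita_def
proof (rule theI'[of "is_levi_civita_at g x"], rule ex1_levi_civita_at)
  show "bilinear (g x)" "\<And>v w. g x v w = g x w v" using U bil sym by auto
  show "dir_deriv (\<lambda>y. g y v w) u x = dir_deriv (\<lambda>y. g y w v) u x" for u v w
  proof (rule frechet_derivative_eqI, rule has_derivative_transform_within_open[OF _ U])
    show "((\<lambda>y. g y w v) has_derivative (\<lambda>u. dir_deriv (\<lambda>y. g y w v) u x)) (at x)"
      using diff frechet_derivative_works by blast
  qed (simp add: sym)
qed (use nd linear_dir_deriv[OF diff] bilinear_dir_deriv_parameter[OF U bil diff] in blast)+

text \<open>With \<open>w\<close> the negative gradient of \<open>\<Phi>\<close>, the Christoffel symbols enter the Hessian only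
  through \<open>g (\<Gamma> v v) w\<close>, which Koszul's formula expresses by first derivatives of \<open>g\<close>.\<close>

lemma hessian_via_gradient:
  fixes g :: "'m::euclidean_space \<Rightarrow> 'm \<Rightarrow> 'm \<Rightarrow> real"
  assumes lc: "is_levi_civita_at g x (levi_civita g x)"
    and sym: "\<And>u v. g x u v = g x v u"
    and w: "\<And>u. g x w u = - dir_deriv \<Phi> u x"
  shows "hessian g \<Phi> x v v = dir_deriv (dir_deriv \<Phi> v) v x
    + (dir_deriv (\<lambda>y. g y v w) v x - dir_deriv (\<lambda>y. g y v v) w x / 2)"
proof -
  define G where "G = levi_civita g x"
  have s: "G a b = G b a" and c: "dir_deriv (\<lambda>y. g y b d) a x = g x (G a b) d + g x b (G a d)" for a b d
    using lc by (simp_all add: is_levi_civita_at_def G_def)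
  have "dir_deriv (\<lambda>y. g y v w) v x - dir_deriv (\<lambda>y. g y v v) w x / 2 = g x w (G v v)"
    using c[of v w v] c[of v v w] sym[of "G w v" v] s[of v w] sym[of w "G v v"] by simp
  then show ?thesis by (simp add: hessian_def w G_def)
qed

section \<open>Stationary metrics in a chart\<close>

lemma smooth_on_imp_differentiable:
  assumes "smooth_on U f" "x \<in> U"
  shows "f differentiable (at x)"
proof -
  have "Ck_on (Suc 0) U f" using assms(1) unfolding smooth_on_def by blast
  then show ?thesis using assms(2) by simp
qed

text \<open>A standard stationary spacetime seen in one chart \<open>c\<close> of \<open>S\<close>.  The coordinate expressions
  of \<open>g\<^sub>0\<close>, \<open>\<omega>\<^sub>0\<close>, \<open>\<beta>\<close> on the chart image \<open>U\<close> are called \<open>G\<close>, \<open>W\<close>, \<open>B\<close>.\<close>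

locale stationary_chart =
  fixes S :: "'a topology" and A :: "('a, 'm::euclidean_space) chart set"
    and g\<^sub>0 :: "('a, 'm) chart \<Rightarrow> 'm \<Rightarrow> 'm \<Rightarrow> 'm \<Rightarrow> real"
    and \<omega>\<^sub>0 :: "('a, 'm) chart \<Rightarrow> 'm \<Rightarrow> 'm \<Rightarrow> real"
    and \<beta> :: "'a \<Rightarrow> real" and c :: "('a, 'm) chart"
  assumes stationary: "standard_stationary S A g\<^sub>0 \<omega>\<^sub>0 \<beta>" and chart: "c \<in> A"
begin

abbreviation U where "U \<equiv> chart_image c"
abbreviation G where "G \<equiv> g\<^sub>0 c"
abbreviation W where "W \<equiv> \<omega>\<^sub>0 c"
abbreviation B where "B \<equiv> \<beta> \<circ> chart_inv c"
abbreviation metric where "metric \<equiv> stationary_metric g\<^sub>0 \<omega>\<^sub>0 \<beta> c"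

text \<open>Derivatives of the coefficients in the direction \<open>u\<close>, with the arguments held constant.\<close>

abbreviation DG where "DG x u y z \<equiv> dir_deriv (\<lambda>x. G x y z) u x"
abbreviation DW where "DW x u y \<equiv> dir_deriv (\<lambda>x. W x y) u x"
abbreviation DB where "DB x u \<equiv> dir_deriv B u x"

lemma metric_eq:
  "metric (x, t) (y, \<tau>) (y', \<tau>') = G x y y' + W x y * \<tau>' + W x y' * \<tau> - B x * \<tau> * \<tau>'"
  by (simp add: stationary_metric_def)

lemma open_U: "open U"
  using stationary chart by (simp add: standard_stationary_def smooth_manifold_def)

lemma riemannian_at:
  assumes "x \<in> U"
  shows "bilinear (G x) \<and> (\<forall>v w. G x v w = G x w v) \<and> (\<forall>v. v \<noteq> 0 \<longrightarrow> G x v v > 0)"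
proof -
  have "\<forall>c\<in>A. \<forall>x\<in>chart_image c. bilinear (g\<^sub>0 c x) \<and>
      (\<forall>v w. g\<^sub>0 c x v w = g\<^sub>0 c x w v) \<and> (\<forall>v. v \<noteq> 0 \<longrightarrow> g\<^sub>0 c x v v > 0)"
    using stationary unfolding standard_stationary_def riemannian_metric_def by (elim conjE)
  then show ?thesis using chart assms by fast
qed

lemma bilinear_G: "x \<in> U \<Longrightarrow> bilinear (G x)"
  and sym_G: "x \<in> U \<Longrightarrow> G x v w = G x w v"
  and pos_G: "x \<in> U \<Longrightarrow> v \<noteq> 0 \<Longrightarrow> G x v v > 0"
  using riemannian_at[of x] by simp_all

lemma linear_W:
  assumes "x \<in> U"
  shows "linear (W x)"
proof -
  have "\<forall>c\<in>A. \<forall>x\<in>chart_image c. linear (\<omega>\<^sub>0 c x)"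
    using stationary unfolding standard_stationary_def one_form_def by (elim conjE)
  then show ?thesis using chart assms by fast
qed

lemma pos_B:
  assumes "x \<in> U"
  shows "B x > 0"
proof -
  have "openin S (fst c)"
    using stationary chart by (simp add: standard_stationary_def smooth_manifold_def)
  moreover have "chart_inv c x \<in> fst c"
    using assms by (simp add: chart_inv_def inv_into_into)
  ultimately have "chart_inv c x \<in> topspace S" using openin_subset by blast
  then show ?thesis using stationary by (simp add: standard_stationary_def)
qed

lemma differentiable_G:
  assumes "x \<in> U"
  shows "(\<lambda>x. G x v w) differentiable (at x)"
proof -
  have "\<forall>c\<in>A. \<forall>v w. smooth_on (chart_image c) (\<lambda>x. g\<^sub>0 c x v w)"
    using stationary unfolding standard_stationary_def riemannian_metric_def by (elim conjE)
  then show ?thesis using chart assms smooth_on_imp_differentiable by fast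
qed

lemma differentiable_W:
  assumes "x \<in> U"
  shows "(\<lambda>x. W x v) differentiable (at x)"
proof -
  have "\<forall>c\<in>A. \<forall>v. smooth_on (chart_image c) (\<lambda>x. \<omega>\<^sub>0 c x v)"
    using stationary unfolding standard_stationary_def one_form_def by (elim conjE)
  then show ?thesis using chart assms smooth_on_imp_differentiable by fast
qed

lemma differentiable_B:
  assumes "x \<in> U"
  shows "B differentiable (at x)"
proof -
  have "\<forall>c\<in>A. smooth_on (chart_image c) (\<beta> \<circ> chart_inv c)"
    using stationary unfolding standard_stationary_def smooth_function_def by (elim conjE)
  then show ?thesis using chart assms smooth_on_imp_differentiable by fast
qed

lemma linear_DG: "x \<in> U \<Longrightarrow> linear (\<lambda>u. DG x u y z)"
  and linear_DW: "x \<in> U \<Longrightarrow> linear (\<lambda>u. DW x u y)"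
  and linear_DB: "x \<in> U \<Longrightarrow> linear (DB x)"
  using linear_dir_deriv differentiable_G differentiable_W differentiable_B by blast+

lemma bilinear_DG: "x \<in> U \<Longrightarrow> bilinear (DG x u)"
  using bilinear_dir_deriv_parameter[OF open_U _ bilinear_G differentiable_G] by blast

lemma linear_DW_parameter: "x \<in> U \<Longrightarrow> linear (DW x u)"
  using linear_dir_deriv_parameter[OF open_U _ linear_W differentiable_W] by blast

lemma has_derivative_metric:
  assumes x: "x \<in> U"
  shows "((\<lambda>z. metric z (y, \<tau>) (y', \<tau>')) has_derivative
    (\<lambda>u. DG x (fst u) y y' + DW x (fst u) y * \<tau>' + DW x (fst u) y' * \<tau> - DB x (fst u) * \<tau> * \<tau>'))
    (at (x, t))"
proof -
  have fst': "(f \<circ> fst has_derivative (\<lambda>u. dir_deriv f (fst u) x)) (at (x, t))"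
    if "f differentiable (at x)" for f :: "'m \<Rightarrow> real"
  proof -
    have "(f has_derivative (\<lambda>u. dir_deriv f u x)) (at (fst (x, t)))"
      using that frechet_derivative_works by force
    from diff_chain_at[OF has_derivative_fst[OF has_derivative_ident] this]
    show ?thesis by (simp add: o_def)
  qed
  have eq: "(\<lambda>z. metric z (y, \<tau>) (y', \<tau>')) = (\<lambda>z. ((\<lambda>x. G x y y') \<circ> fst) z
      + ((\<lambda>x. W x y) \<circ> fst) z * \<tau>' + ((\<lambda>x. W x y') \<circ> fst) z * \<tau> - (B \<circ> fst) z * \<tau> * \<tau>')"
    by (auto simp: stationary_metric_def)
  show ?thesis
    unfolding eq
    by (intro has_derivative_add has_derivative_diff has_derivative_mult_left fst'
        differentiable_G[OF x] differentiable_W[OF x] differentiable_B[OF x])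
qed

lemma bilinear_metric:
  assumes "x \<in> U"
  shows "bilinear (metric (x, t))"
  unfolding bilinear_def
  by (intro conjI allI linearI;
      clarsimp simp: metric_eq bilinear_ladd[OF bilinear_G[OF assms]]
        bilinear_radd[OF bilinear_G[OF assms]] bilinear_lmul[OF bilinear_G[OF assms]]
        bilinear_rmul[OF bilinear_G[OF assms]] linear_add[OF linear_W[OF assms]]
        linear_cmul[OF linear_W[OF assms]] algebra_simps)

lemma sym_metric: "x \<in> U \<Longrightarrow> metric (x, t) v w = metric (x, t) w v"
  by (cases v; cases w) (simp add: metric_eq sym_G[of x "fst v"] sym_G algebra_simps)

lemma nondegenerate_metric:
  assumes x: "x \<in> U" and v: "\<forall>w. metric (x, t) v w = 0"
  shows "v = 0"
proof -
  obtain a b where ab: "v = (a, b)" by fastforce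
  have 1: "W x a = B x * b"
    using v[rule_format, of "(0, 1)"]
    by (simp add: ab metric_eq bilinear_rzero[OF bilinear_G[OF x]] linear_0[OF linear_W[OF x]])
  have "G x a a + W x a * b = 0"
    using v[rule_format, of "(a, 0)"] by (simp add: ab metric_eq)
  then have "G x a a + B x * b\<^sup>2 = 0" by (simp add: 1 power2_eq_square)
  moreover have "B x * b\<^sup>2 \<ge> 0" using pos_B[OF x] by simp
  ultimately have "a = 0" using pos_G[OF x, of a] by force
  then show ?thesis using 1 pos_B[OF x] by (simp add: ab zero_prod_def linear_0[OF linear_W[OF x]])
qed

lemma is_levi_civita_at_metric:
  assumes x: "x \<in> U"
  shows "is_levi_civita_at metric (x, t) (levi_civita metric (x, t))"
proof (rule is_levi_civita_at_levi_civita[where U = "U \<times> UNIV"])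
  show "open (U \<times> (UNIV :: real set))" by (simp add: open_Times open_U)
  show "(\<lambda>z. metric z v w) differentiable (at (x, t))" for v w
    using has_derivative_metric[OF x] unfolding differentiable_def by (cases v; cases w) blast
  show "v = 0" if "\<forall>w. metric (x, t) v w = 0" for v
    using nondegenerate_metric[OF x that] .
  show "bilinear (metric z)" if "z \<in> U \<times> UNIV" for z
    using that bilinear_metric by (cases z) simp
  show "metric z v w = metric z w v" if "z \<in> U \<times> UNIV" for z v w
    using that by (cases z) (auto intro: sym_metric)
qed (use x in simp)

end

section \<open>The Hessian of the cylinder function\<close>

lemma dir_deriv_const_minus_norm_sq:
  fixes \<Phi> :: "'m::euclidean_space \<times> real \<Rightarrow> real"
  assumes "\<Phi> = (\<lambda>(x, t). r\<^sub>0\<^sup>2 - (norm x)\<^sup>2)"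
  shows "dir_deriv \<Phi> v = (\<lambda>z. - 2 * (fst z \<bullet> fst v))"
    and "dir_deriv (dir_deriv \<Phi> v) v z = - 2 * (norm (fst v))\<^sup>2"
proof -
  have "((\<lambda>z. r\<^sub>0\<^sup>2 - fst z \<bullet> fst z) has_derivative (\<lambda>v. - 2 * (fst z \<bullet> fst v))) (at z)" for z :: "'m \<times> real"
    by (auto intro!: derivative_eq_intros simp: inner_commute)
  moreover have "\<Phi> = (\<lambda>z. r\<^sub>0\<^sup>2 - fst z \<bullet> fst z)"
    using assms by (auto simp: power2_norm_eq_inner)
  ultimately show 1: "dir_deriv \<Phi> v = (\<lambda>z. - 2 * (fst z \<bullet> fst v))"
    using frechet_derivative_eqI by blast
  have "((\<lambda>z. - 2 * (fst z \<bullet> fst v)) has_derivative (\<lambda>u. - 2 * (fst u \<bullet> fst v))) (at z)"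
    by (auto intro!: derivative_eq_intros)
  then show "dir_deriv (dir_deriv \<Phi> v) v z = - 2 * (norm (fst v))\<^sup>2"
    unfolding 1 by (simp add: frechet_derivative_eqI power2_norm_eq_inner)
qed

context stationary_chart
begin

text \<open>The numbers \<open>e\<close>, \<open>w\<close>, \<open>s\<close> measure how far \<open>G\<close>, \<open>W\<close>, \<open>B\<close> are from the Minkowski values at
  \<open>x\<close>, derivatives being weighted by \<open>|x|\<close>.\<close>

lemma hessian_estimate:
  fixes \<Phi> :: "'m \<times> real \<Rightarrow> real"
  assumes \<Phi>: "\<Phi> = (\<lambda>(x, t). r\<^sub>0\<^sup>2 - (norm x)\<^sup>2)"
    and x: "x \<in> U" "x \<noteq> 0" and e: "e \<le> 1 / 2"
    and G: "\<And>y z. \<bar>G x y z - y \<bullet> z\<bar> \<le> e * norm y * norm z"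
    and DG: "\<And>u y z. norm x * \<bar>DG x u y z\<bar> \<le> e * norm u * norm y * norm z"
    and W: "\<And>y. \<bar>W x y\<bar> \<le> w * norm y"
    and DW: "\<And>u y. norm x * \<bar>DW x u y\<bar> \<le> w * norm u * norm y"
    and B: "B x \<ge> 1 / 2"
    and DB: "\<And>u. norm x * \<bar>DB x u\<bar> \<le> s * norm u"
    and nn: "0 \<le> e" "0 \<le> w" "0 \<le> s"
  shows "\<bar>hessian metric \<Phi> (x, t) (y, \<tau>) (y, \<tau>) + 2 * (norm y)\<^sup>2 - DB x x * \<tau>\<^sup>2\<bar>
    \<le> (6 * e + 8 * w\<^sup>2) * (norm y)\<^sup>2 + 8 * w * (1 + s) * (norm y * \<bar>\<tau>\<bar>)
      + 2 * s * (e + 2 * w\<^sup>2) * \<tau>\<^sup>2"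
proof -
  define r where "r = norm x"
  have r: "r > 0" using x by (simp add: r_def)
  \<comment> \<open>The vector \<open>(a, b)\<close> is the negative gradient of \<open>\<Phi>\<close>.\<close>
  have "\<exists>z. \<forall>u. metric (x, t) z u = 2 * (x \<bullet> fst u)"
  proof (rule nondegenerate_represents[OF bilinear_metric[OF x(1)]])
    show "v = 0" if "\<forall>u. metric (x, t) v u = 0" for v
      using nondegenerate_metric[OF x(1) that] .
    show "linear (\<lambda>u :: 'm \<times> real. 2 * (x \<bullet> fst u))"
      by (rule linearI) (simp_all add: inner_add_right)
  qed
  then obtain a b where ab: "\<And>u. metric (x, t) (a, b) u = 2 * (x \<bullet> fst u)"
    by (metis surj_pair)
  have Wb: "W x a = B x * b"
    using ab[of "(0, 1)"]
    by (simp add: metric_eq bilinear_rzero[OF bilinear_G[OF x(1)]] linear_0[OF linear_W[OF x(1)]])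
  have Ga: "G x a z + W x z * b = 2 * (x \<bullet> z)" for z
    using ab[of "(z, 0)"] by (simp add: metric_eq)
  have bound_a: "norm a \<le> 4 * r"
  proof -
    have "(norm a)\<^sup>2 / 2 \<le> (norm a)\<^sup>2 - e * norm a * norm a"
      using mult_right_mono[OF e, of "(norm a)\<^sup>2"] by (simp add: power2_eq_square mult_ac)
    also have "\<dots> \<le> G x a a" using G[of a a] by (simp add: power2_norm_eq_inner)
    also have "\<dots> \<le> G x a a + B x * b\<^sup>2" using pos_B[OF x(1)] by simp
    also have "\<dots> = 2 * (x \<bullet> a)" using Ga[of a] by (simp add: Wb power2_eq_square mult_ac)
    also have "\<dots> \<le> 2 * (r * norm a)" by (simp add: r_def norm_cauchy_schwarz)
    finally have "norm a * norm a \<le> (4 * r) * norm a" by (simp add: power2_eq_square)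
    then show ?thesis using r by (cases "norm a = 0") auto
  qed
  have bound_b: "\<bar>b\<bar> \<le> 8 * w * r"
  proof -
    have "\<bar>b\<bar> / 2 \<le> B x * \<bar>b\<bar>" using B mult_right_mono[of "1/2" "B x" "\<bar>b\<bar>"] by simp
    also have "\<dots> = \<bar>W x a\<bar>" using pos_B[OF x(1)] by (simp add: Wb abs_mult)
    also have "\<dots> \<le> w * norm a" by (rule W)
    also have "\<dots> \<le> w * (4 * r)" using bound_a nn by (intro mult_left_mono) auto
    finally show ?thesis by simp
  qed
  have bound_diff: "norm (a - 2 *\<^sub>R x) \<le> (e + 2 * w\<^sup>2) * (4 * r)"
  proof -
    define d where "d = a - 2 *\<^sub>R x"
    have "(norm d)\<^sup>2 = (a \<bullet> d - G x a d) - W x d * b"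
      using Ga[of d] by (simp add: power2_norm_eq_inner d_def inner_diff_left inner_scaleR_left)
    also have "\<dots> \<le> e * norm a * norm d + \<bar>W x d\<bar> * \<bar>b\<bar>"
      using G[of a d] abs_mult[of "W x d" b] by linarith
    also have "\<dots> \<le> e * (4 * r) * norm d + (w * norm d) * (8 * w * r)"
      using nn r by (intro add_mono mult_mono bound_a bound_b W) auto
    also have "\<dots> = (e + 2 * w\<^sup>2) * (4 * r) * norm d" by (simp add: algebra_simps power2_eq_square)
    finally have "norm d * norm d \<le> (e + 2 * w\<^sup>2) * (4 * r) * norm d" by (simp add: power2_eq_square)
    then show ?thesis using r nn unfolding d_def[symmetric] by (cases "norm d = 0") auto
  qed
  note dPhi = dir_deriv_const_minus_norm_sq[OF \<Phi>]
  note dmet = frechet_derivative_eqI[OF has_derivative_metric[OF x(1)]]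
  have "hessian metric \<Phi> (x, t) (y, \<tau>) (y, \<tau>) = - 2 * (norm y)\<^sup>2
      + ((DG x y y a + DW x y y * b + DW x y a * \<tau> - DB x y * \<tau> * b)
         - (DG x a y y + DW x a y * \<tau> + DW x a y * \<tau> - DB x a * \<tau> * \<tau>) / 2)"
  proof (subst hessian_via_gradient[OF is_levi_civita_at_metric[OF x(1)], where w = "(a, b)"])
    show "metric (x, t) u v = metric (x, t) v u" for u v by (rule sym_metric[OF x(1)])
    show "metric (x, t) (a, b) u = - dir_deriv \<Phi> u (x, t)" for u by (simp add: ab fun_cong[OF dPhi(1)])
  qed (simp only: dPhi(2) dmet fst_conv)
  moreover have "DB x a = DB x (a - 2 *\<^sub>R x) + 2 * DB x x"
    by (simp add: linear_diff[OF linear_DB[OF x(1)]] linear_cmul[OF linear_DB[OF x(1)]])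
  ultimately have H: "hessian metric \<Phi> (x, t) (y, \<tau>) (y, \<tau>) + 2 * (norm y)\<^sup>2 - DB x x * \<tau>\<^sup>2
      = DG x y y a - DG x a y y / 2 + DW x y y * b + (DW x y a - DW x a y) * \<tau> - DB x y * \<tau> * b
        + DB x (a - 2 *\<^sub>R x) / 2 * \<tau>\<^sup>2"
    by (simp add: field_simps power2_eq_square)
  have G1: "\<bar>DG x y y a\<bar> \<le> 4 * e * (norm y)\<^sup>2"
  proof -
    have "r * \<bar>DG x y y a\<bar> \<le> e * norm y * norm y * (4 * r)"
      unfolding r_def
      by (rule order_trans[OF DG]) (use nn bound_a in \<open>auto simp: r_def intro!: mult_left_mono\<close>)
    then have "r * \<bar>DG x y y a\<bar> \<le> r * (4 * e * (norm y)\<^sup>2)" by (simp add: power2_eq_square mult_ac)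
    then show ?thesis using r by simp
  qed
  have G2: "\<bar>DG x a y y\<bar> \<le> 4 * e * (norm y)\<^sup>2"
  proof -
    have "r * \<bar>DG x a y y\<bar> \<le> e * norm a * (norm y * norm y)"
      using DG[where u = a and y = y and z = y] by (simp add: r_def mult_ac)
    also have "\<dots> \<le> e * (4 * r) * (norm y * norm y)"
      using nn bound_a by (intro mult_right_mono mult_left_mono) auto
    finally have "r * \<bar>DG x a y y\<bar> \<le> r * (4 * e * (norm y)\<^sup>2)" by (simp add: power2_eq_square mult_ac)
    then show ?thesis using r by simp
  qed
  have W1: "\<bar>DW x y y * b\<bar> \<le> 8 * w\<^sup>2 * (norm y)\<^sup>2"
  proof -
    have "r * \<bar>DW x y y * b\<bar> = (r * \<bar>DW x y y\<bar>) * \<bar>b\<bar>" by (simp add: abs_mult)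
    also have "\<dots> \<le> (w * norm y * norm y) * (8 * w * r)"
      using DW[where u = y and y = y] nn by (intro mult_mono[OF _ bound_b]) (simp_all add: r_def)
    finally have "r * \<bar>DW x y y * b\<bar> \<le> r * (8 * w\<^sup>2 * (norm y)\<^sup>2)"
      by (simp add: power2_eq_square mult_ac)
    then show ?thesis using r by simp
  qed
  have W2: "\<bar>(DW x y a - DW x a y) * \<tau>\<bar> \<le> 8 * w * (norm y * \<bar>\<tau>\<bar>)"
  proof -
    have "r * \<bar>DW x y a - DW x a y\<bar> \<le> r * \<bar>DW x y a\<bar> + r * \<bar>DW x a y\<bar>"
      using r by (simp add: distrib_left[symmetric])
    also have "\<dots> \<le> 2 * (w * norm y) * norm a"
      using DW[where u = y and y = a] DW[where u = a and y = y] by (simp add: r_def mult_ac)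
    also have "\<dots> \<le> 2 * (w * norm y) * (4 * r)"
      using nn bound_a by (intro mult_left_mono) auto
    finally have "r * \<bar>DW x y a - DW x a y\<bar> \<le> r * (8 * w * norm y)" by (simp add: mult_ac)
    then have "\<bar>DW x y a - DW x a y\<bar> \<le> 8 * w * norm y" using r by simp
    from mult_right_mono[OF this abs_ge_zero[of \<tau>]] show ?thesis by (simp add: abs_mult mult_ac)
  qed
  have B1: "\<bar>DB x y * \<tau> * b\<bar> \<le> 8 * w * s * (norm y * \<bar>\<tau>\<bar>)"
  proof -
    have "r * \<bar>DB x y * \<tau> * b\<bar> = (r * \<bar>DB x y\<bar>) * \<bar>\<tau>\<bar> * \<bar>b\<bar>" by (simp add: abs_mult)
    also have "\<dots> \<le> (s * norm y) * \<bar>\<tau>\<bar> * (8 * w * r)"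
      using DB[of y] nn by (intro mult_mono[OF mult_right_mono bound_b]) (simp_all add: r_def)
    finally have "r * \<bar>DB x y * \<tau> * b\<bar> \<le> r * (8 * w * s * (norm y * \<bar>\<tau>\<bar>))"
      by (simp add: mult_ac)
    then show ?thesis using r by simp
  qed
  have B2: "\<bar>DB x (a - 2 *\<^sub>R x) / 2 * \<tau>\<^sup>2\<bar> \<le> 2 * s * (e + 2 * w\<^sup>2) * \<tau>\<^sup>2"
  proof -
    have "r * \<bar>DB x (a - 2 *\<^sub>R x)\<bar> \<le> s * ((e + 2 * w\<^sup>2) * (4 * r))"
      unfolding r_def
      by (rule order_trans[OF DB]) (use nn bound_diff in \<open>auto simp: r_def intro!: mult_left_mono\<close>)
    then have "r * \<bar>DB x (a - 2 *\<^sub>R x)\<bar> \<le> r * (4 * s * (e + 2 * w\<^sup>2))" by (simp add: mult_ac)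
    then have "\<bar>DB x (a - 2 *\<^sub>R x)\<bar> / 2 \<le> 2 * s * (e + 2 * w\<^sup>2)" using r by simp
    from mult_right_mono[OF this zero_le_power2[of \<tau>]] show ?thesis by (simp add: abs_mult)
  qed
  have "8 * w * (1 + s) * (norm y * \<bar>\<tau>\<bar>) = 8 * w * (norm y * \<bar>\<tau>\<bar>) + 8 * w * s * (norm y * \<bar>\<tau>\<bar>)"
    "(6 * e + 8 * w\<^sup>2) * (norm y)\<^sup>2 = 4 * e * (norm y)\<^sup>2 + 4 * e * (norm y)\<^sup>2 / 2 + 8 * w\<^sup>2 * (norm y)\<^sup>2"
    by (simp_all add: algebra_simps)
  then show ?thesis
    using G1 G2 W1 W2 B1 B2 unfolding H abs_le_iff by linarith
qed

end

section \<open>Operator bounds from bounds on components\<close>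

lemma linear_eq_sum_axis:
  fixes f :: "real^'n::finite \<Rightarrow> real"
  assumes "linear f"
  shows "f u = (\<Sum>l\<in>UNIV. u $ l * f (axis l 1))"
proof -
  have "f u = f (\<Sum>l\<in>UNIV. u $ l *\<^sub>R axis l 1)"
    using basis_expansion[of u] by (simp add: scalar_mult_eq_scaleR)
  also have "\<dots> = (\<Sum>l\<in>UNIV. u $ l * f (axis l 1))"
    by (simp add: linear_sum[OF assms] linear_cmul[OF assms])
  finally show ?thesis .
qed

lemma linear_bound_axis:
  fixes f :: "real^'n::finite \<Rightarrow> real"
  assumes "linear f"
  shows "\<bar>f u\<bar> \<le> (\<Sum>l\<in>UNIV. \<bar>f (axis l 1)\<bar>) * norm u"
proof -
  have "\<bar>f u\<bar> \<le> (\<Sum>l\<in>UNIV. \<bar>u $ l * f (axis l 1)\<bar>)"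
    unfolding linear_eq_sum_axis[OF assms, of u] by (rule sum_abs)
  also have "\<dots> \<le> (\<Sum>l\<in>UNIV. \<bar>f (axis l 1)\<bar> * norm u)"
    by (intro sum_mono) (simp add: abs_mult mult.commute[of _ "norm u"] component_le_norm_cart mult_right_mono)
  finally show ?thesis by (simp add: sum_distrib_right)
qed

lemma bilinear_bound_axis:
  fixes f :: "real^'n::finite \<Rightarrow> real^'n \<Rightarrow> real"
  assumes "bilinear f"
  shows "\<bar>f y z\<bar> \<le> (\<Sum>i\<in>UNIV. \<Sum>j\<in>UNIV. \<bar>f (axis i 1) (axis j 1)\<bar>) * norm y * norm z"
proof -
  have l: "linear (f y)" "linear (\<lambda>y. f y z)" for y z using assms by (simp_all add: bilinear_def)
  have "\<bar>f y z\<bar> \<le> (\<Sum>i\<in>UNIV. \<bar>f (axis i 1) z\<bar>) * norm y"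
    using linear_bound_axis[OF l(2)] .
  also have "\<dots> \<le> (\<Sum>i\<in>UNIV. (\<Sum>j\<in>UNIV. \<bar>f (axis i 1) (axis j 1)\<bar>) * norm z) * norm y"
    by (intro mult_right_mono sum_mono linear_bound_axis l norm_ge_zero)
  finally show ?thesis by (simp add: sum_distrib_left sum_distrib_right mult_ac)
qed

lemma eventually_bound_of_bigo:
  fixes N :: "'b::real_normed_vector \<Rightarrow> real"
  assumes "N \<in> O[at_infinity](\<lambda>x. 1 / norm x powr p)"
  shows "\<exists>K. \<forall>L\<ge>K. \<forall>\<^sub>F x in at_infinity. N x \<le> L * norm x powr - p"
proof -
  obtain K where K: "\<forall>\<^sub>F x in at_infinity. norm (N x) \<le> K * norm (1 / norm x powr p)"
    using landau_o.bigE[OF assms] by blast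
  have "\<forall>\<^sub>F x in at_infinity. N x \<le> L * norm x powr - p" if L: "L \<ge> K" for L
    using K
  proof eventually_elim
    case (elim x)
    have "N x \<le> norm (N x)" by simp
    also have "\<dots> \<le> K * norm x powr - p" using elim by (simp add: powr_minus_divide)
    also have "\<dots> \<le> L * norm x powr - p" using L by (intro mult_right_mono) auto
    finally show ?case .
  qed
  then show ?thesis by blast
qed

section \<open>Asymptotics at an end\<close>

lemma tendsto_norm_powr_neg:
  assumes "p > 0"
  shows "((\<lambda>x::'b::real_normed_vector. norm x powr - p) \<longlongrightarrow> 0) at_infinity"
  using tendsto_neg_powr[OF _ filterlim_norm_at_top, of "- p"] assms by simp

lemma eventually_norm_powr_neg_less:
  assumes "p > 0" "\<epsilon> > 0"
  shows "\<forall>\<^sub>F x::'b::real_normed_vector in at_infinity. K * norm x powr - p < \<epsilon>"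
  using order_tendstoD(2)[OF tendsto_mult_right_zero[OF tendsto_norm_powr_neg[OF assms(1)]] assms(2)] .

lemma eventually_sphere:
  assumes "\<forall>\<^sub>F x::'b::real_normed_vector in at_infinity. P x"
  shows "\<forall>\<^sub>F r in at_top. r > 0 \<and> (\<forall>x. norm x = r \<longrightarrow> P x)"
proof -
  obtain b where "\<And>x. norm x \<ge> b \<Longrightarrow> P x" using assms by (auto simp: eventually_at_infinity)
  then have "r > 0 \<and> (\<forall>x. norm x = r \<longrightarrow> P x)" if "r \<ge> max b 1" for r using that by auto
  then show ?thesis unfolding eventually_at_top_linorder by blast
qed

text \<open>The factor \<open>3 / 4\<close> leaves room for error terms up to \<open>C / 4\<close> on either side.\<close>

lemma asymp_equiv_powr_lower_bound:
  fixes f :: "'b::real_normed_vector \<Rightarrow> real"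
  assumes f: "f \<sim>[at_infinity] (\<lambda>x. C / norm x powr (q + 1))" and C: "C > 0"
  shows "\<forall>\<^sub>F x in at_infinity. norm x * f x \<ge> 3 / 4 * C * norm x powr - q"
proof -
  define g where "g x = C / norm x powr (q + 1)" for x :: 'b
  have "\<forall>\<^sub>F x in at_infinity. 3 / 4 < (if f x = 0 \<and> g x = 0 then 1 else f x / g x)"
    unfolding g_def by (rule order_tendstoD(1)[OF asymp_equivD[OF f]]) simp
  moreover have "\<forall>\<^sub>F x::'b in at_infinity. norm x \<ge> 1"
    by (auto simp: eventually_at_infinity)
  ultimately show ?thesis
  proof eventually_elim
    case (elim x)
    have "x \<noteq> 0" using elim(2) by auto
    then have g: "g x > 0" using C by (simp add: g_def)
    then have "3 / 4 * g x \<le> f x" using elim(1) by (simp add: field_simps)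
    then have "norm x * (3 / 4 * g x) \<le> norm x * f x" by (intro mult_left_mono) auto
    moreover have "norm x * g x = C * norm x powr - q"
      using elim(2) by (simp add: g_def powr_add powr_minus_divide)
    ultimately show ?case by simp
  qed
qed

text \<open>The chart of one end, with image \<open>\<real>\<^sup>n - {0}\<close> and the fall-off of the coefficients.\<close>

locale asymptotic_end = stationary_chart S A g\<^sub>0 \<omega>\<^sub>0 \<beta> c
  for S :: "'a topology" and A :: "('a, real^'n::finite) chart set"
    and g\<^sub>0 \<omega>\<^sub>0 \<beta> c +
  fixes p\<^sub>0 q\<^sub>0 q' :: real
  assumes image: "chart_image c = UNIV - {0}"
    and pos: "p\<^sub>0 > 0" "q\<^sub>0 > 0" "q' > 0"
    and fall: "fall_off g\<^sub>0 \<omega>\<^sub>0 \<beta> p\<^sub>0 q\<^sub>0 q' c"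
begin

lemma in_U: "x \<noteq> 0 \<Longrightarrow> x \<in> U"
  by (simp add: image)

lemma DB_radial: "x \<noteq> 0 \<Longrightarrow> DB x x = norm x * radial_deriv B x"
  unfolding radial_deriv_def linear_eq_sum_axis[OF linear_DB[OF in_U], of x x]
  by (simp add: sum_distrib_left)

text \<open>The fall-off conditions at the point \<open>x\<close> with explicit constant \<open>K\<close>, as bounds for the
  multilinear maps instead of their components.\<close>

definition fall_off_bound :: "real \<Rightarrow> real^'n \<Rightarrow> bool" where
  "fall_off_bound K x \<longleftrightarrow>
    (\<forall>y z. \<bar>G x y z - y \<bullet> z\<bar> \<le> K * norm x powr - p\<^sub>0 * norm y * norm z) \<and>
    (\<forall>u y z. norm x * \<bar>DG x u y z\<bar> \<le> K * norm x powr - p\<^sub>0 * norm u * norm y * norm z) \<and>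
    (\<forall>y. \<bar>W x y\<bar> \<le> K * norm x powr - q\<^sub>0 * norm y) \<and>
    (\<forall>u y. norm x * \<bar>DW x u y\<bar> \<le> K * norm x powr - q\<^sub>0 * norm u * norm y) \<and>
    \<bar>B x - 1\<bar> \<le> K * norm x powr - q' \<and>
    (\<forall>u. norm x * \<bar>DB x u\<bar> \<le> K * norm x powr - q' * norm u)"

lemma eventually_fall_off_bound:
  "\<exists>K>0. \<forall>\<^sub>F x in at_infinity. x \<noteq> 0 \<and> fall_off_bound K x"
proof -
  define e where "e i = (axis i 1 :: real^'n)" for i
  define N1 where "N1 x = (\<Sum>i\<in>UNIV. \<Sum>j\<in>UNIV. \<bar>G x (e i) (e j) - e i \<bullet> e j\<bar>)" for x
  define N2 where "N2 x = (\<Sum>l\<in>UNIV. \<Sum>i\<in>UNIV. \<Sum>j\<in>UNIV. \<bar>norm x * DG x (e l) (e i) (e j)\<bar>)" for x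
  define N3 where "N3 x = (\<Sum>j\<in>UNIV. \<bar>W x (e j)\<bar>)" for x
  define N4 where "N4 x = (\<Sum>l\<in>UNIV. \<Sum>j\<in>UNIV. \<bar>norm x * DW x (e l) (e j)\<bar>)" for x
  define N5 where "N5 x = \<bar>B x - 1\<bar>" for x
  define N6 where "N6 x = (\<Sum>l\<in>UNIV. \<bar>norm x * DB x (e l)\<bar>)" for x
  note fo = fall[unfolded fall_off_def Let_def]
  have fo1: "(\<lambda>x. G x (e i) (e j) - e i \<bullet> e j) \<in> O[at_infinity](\<lambda>x. 1 / norm x powr p\<^sub>0)" for i j
  proof -
    have "e i \<bullet> e j = (if i = j then 1 else 0)" by (simp add: e_def inner_axis_axis)
    then show ?thesis using fo by (simp only: e_def)
  qed
  have fo2: "(\<lambda>x. norm x * DG x (e l) (e i) (e j)) \<in> O[at_infinity](\<lambda>x. 1 / norm x powr p\<^sub>0)" for l i j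
    using fo by (simp only: e_def)
  have fo3: "(\<lambda>x. W x (e j)) \<in> O[at_infinity](\<lambda>x. 1 / norm x powr q\<^sub>0)" for j
    using fo by (simp only: e_def)
  have fo4: "(\<lambda>x. norm x * DW x (e l) (e j)) \<in> O[at_infinity](\<lambda>x. 1 / norm x powr q\<^sub>0)" for l j
    using fo by (simp only: e_def)
  have fo5: "(\<lambda>x. B x - 1) \<in> O[at_infinity](\<lambda>x. 1 / norm x powr q')"
    using fo by (simp only:)
  have fo6: "(\<lambda>x. norm x * DB x (e l)) \<in> O[at_infinity](\<lambda>x. 1 / norm x powr q')" for l
    using fo by (simp only: e_def)
  have "N1 \<in> O[at_infinity](\<lambda>x. 1 / norm x powr p\<^sub>0)" "N2 \<in> O[at_infinity](\<lambda>x. 1 / norm x powr p\<^sub>0)"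
    "N3 \<in> O[at_infinity](\<lambda>x. 1 / norm x powr q\<^sub>0)" "N4 \<in> O[at_infinity](\<lambda>x. 1 / norm x powr q\<^sub>0)"
    "N5 \<in> O[at_infinity](\<lambda>x. 1 / norm x powr q')" "N6 \<in> O[at_infinity](\<lambda>x. 1 / norm x powr q')"
    unfolding N1_def[abs_def] N2_def[abs_def] N3_def[abs_def] N4_def[abs_def] N5_def[abs_def]
      N6_def[abs_def]
    by (intro big_sum_in_bigo iffD2[OF landau_o.big.abs_in_iff] fo1 fo2 fo3 fo4 fo5 fo6)+
  note N = this[THEN eventually_bound_of_bigo]
  obtain K1 where K1: "\<And>L. L \<ge> K1 \<Longrightarrow> \<forall>\<^sub>F x in at_infinity. N1 x \<le> L * norm x powr - p\<^sub>0"
    using N(1) by blast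
  obtain K2 where K2: "\<And>L. L \<ge> K2 \<Longrightarrow> \<forall>\<^sub>F x in at_infinity. N2 x \<le> L * norm x powr - p\<^sub>0"
    using N(2) by blast
  obtain K3 where K3: "\<And>L. L \<ge> K3 \<Longrightarrow> \<forall>\<^sub>F x in at_infinity. N3 x \<le> L * norm x powr - q\<^sub>0"
    using N(3) by blast
  obtain K4 where K4: "\<And>L. L \<ge> K4 \<Longrightarrow> \<forall>\<^sub>F x in at_infinity. N4 x \<le> L * norm x powr - q\<^sub>0"
    using N(4) by blast
  obtain K5 where K5: "\<And>L. L \<ge> K5 \<Longrightarrow> \<forall>\<^sub>F x in at_infinity. N5 x \<le> L * norm x powr - q'"
    using N(5) by blast
  obtain K6 where K6: "\<And>L. L \<ge> K6 \<Longrightarrow> \<forall>\<^sub>F x in at_infinity. N6 x \<le> L * norm x powr - q'"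
    using N(6) by blast
  define L where "L = Max {1, K1, K2, K3, K4, K5, K6}"
  have L: "L \<ge> 1" "L \<ge> K1" "L \<ge> K2" "L \<ge> K3" "L \<ge> K4" "L \<ge> K5" "L \<ge> K6"
    unfolding L_def by (intro Max_ge; simp)+
  have "\<forall>\<^sub>F x::real^'n in at_infinity. norm x \<ge> 1" by (auto simp: eventually_at_infinity)
  with K1[OF L(2)] K2[OF L(3)] K3[OF L(4)] K4[OF L(5)] K5[OF L(6)] K6[OF L(7)]
  have "\<forall>\<^sub>F x in at_infinity. x \<noteq> 0 \<and> fall_off_bound L x"
  proof eventually_elim
    case (elim x)
    have x: "x \<noteq> 0" "x \<in> U" using elim(7) in_U[of x] by fastforce+
    have "\<bar>G x y z - y \<bullet> z\<bar> \<le> L * norm x powr - p\<^sub>0 * norm y * norm z" for y z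
    proof -
      have "bilinear (\<lambda>y z. G x y z - y \<bullet> z)"
        using bilinear_G[OF x(2)] unfolding bilinear_def
        by (auto intro!: linear_compose_sub intro: bounded_linear.linear[OF bounded_linear_inner_left]
            bounded_linear.linear[OF bounded_linear_inner_right])
      from bilinear_bound_axis[OF this, of y z]
      have "\<bar>G x y z - y \<bullet> z\<bar> \<le> N1 x * norm y * norm z" by (simp add: N1_def e_def)
      also have "\<dots> \<le> L * norm x powr - p\<^sub>0 * norm y * norm z"
        using elim(1) by (intro mult_right_mono) auto
      finally show ?thesis .
    qed
    moreover have "norm x * \<bar>DG x u y z\<bar> \<le> L * norm x powr - p\<^sub>0 * norm u * norm y * norm z" for u y z
    proof -
      have "\<bar>DG x u y z\<bar> \<le> (\<Sum>l\<in>UNIV. \<bar>DG x (axis l 1) y z\<bar>) * norm u"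
        using linear_bound_axis[OF linear_DG[OF x(2)]] .
      also have "\<dots> \<le> (\<Sum>l\<in>UNIV. (\<Sum>i\<in>UNIV. \<Sum>j\<in>UNIV. \<bar>DG x (axis l 1) (axis i 1) (axis j 1)\<bar>)
          * norm y * norm z) * norm u"
        by (intro mult_right_mono sum_mono bilinear_bound_axis bilinear_DG x norm_ge_zero)
      finally have "norm x * \<bar>DG x u y z\<bar> \<le> norm x * \<dots>" by (intro mult_left_mono) auto
      also have "\<dots> = N2 x * norm u * norm y * norm z"
        by (simp add: N2_def e_def abs_mult sum_distrib_left sum_distrib_right mult_ac)
      also have "\<dots> \<le> L * norm x powr - p\<^sub>0 * norm u * norm y * norm z"
        using elim(2) by (intro mult_right_mono) auto
      finally show ?thesis .
    qed
    moreover have "\<bar>W x y\<bar> \<le> L * norm x powr - q\<^sub>0 * norm y" for y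
      using linear_bound_axis[OF linear_W[OF x(2)], of y] mult_right_mono[OF elim(3) norm_ge_zero[of y]]
      by (simp add: N3_def e_def)
    moreover have "norm x * \<bar>DW x u y\<bar> \<le> L * norm x powr - q\<^sub>0 * norm u * norm y" for u y
    proof -
      have "\<bar>DW x u y\<bar> \<le> (\<Sum>l\<in>UNIV. \<bar>DW x (axis l 1) y\<bar>) * norm u"
        using linear_bound_axis[OF linear_DW[OF x(2)]] .
      also have "\<dots> \<le> (\<Sum>l\<in>UNIV. (\<Sum>j\<in>UNIV. \<bar>DW x (axis l 1) (axis j 1)\<bar>) * norm y) * norm u"
        by (intro mult_right_mono sum_mono linear_bound_axis linear_DW_parameter x norm_ge_zero)
      finally have "norm x * \<bar>DW x u y\<bar> \<le> norm x * \<dots>" by (intro mult_left_mono) auto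
      also have "\<dots> = N4 x * norm u * norm y"
        by (simp add: N4_def e_def abs_mult sum_distrib_left sum_distrib_right mult_ac)
      also have "\<dots> \<le> L * norm x powr - q\<^sub>0 * norm u * norm y"
        using elim(4) by (intro mult_right_mono) auto
      finally show ?thesis .
    qed
    moreover have "norm x * \<bar>DB x u\<bar> \<le> L * norm x powr - q' * norm u" for u
    proof -
      have "norm x * \<bar>DB x u\<bar> \<le> norm x * ((\<Sum>l\<in>UNIV. \<bar>DB x (axis l 1)\<bar>) * norm u)"
        by (intro mult_left_mono linear_bound_axis linear_DB x norm_ge_zero)
      also have "\<dots> = N6 x * norm u"
        by (simp add: N6_def e_def abs_mult sum_distrib_left sum_distrib_right mult_ac)
      also have "\<dots> \<le> L * norm x powr - q' * norm u"
        using elim(6) by (intro mult_right_mono) auto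
      finally show ?thesis .
    qed
    ultimately show ?case using elim(5) x by (simp add: fall_off_bound_def N5_def)
  qed
  then show ?thesis using L(1) by (intro exI[of _ L]) auto
qed

text \<open>The estimate with all error terms measured in the scales that matter at infinity.  Only the
  mixed term, which comes from \<open>\<omega>\<^sub>0\<close>, has a constant that cannot be made small; it is of order
  \<open>|x|\<^sup>-\<^sup>q\<close> with \<open>q = q\<^sub>0\<close>.\<close>

lemma hessian_asymptotics:
  assumes \<epsilon>: "\<epsilon> > 0"
  shows "\<exists>M. \<forall>\<^sub>F x in at_infinity. \<forall>r\<^sub>0 t y \<tau>.
    \<bar>hessian metric (cylinder_fun r\<^sub>0) (x, t) (y, \<tau>) (y, \<tau>) + 2 * (norm y)\<^sup>2 - DB x x * \<tau>\<^sup>2\<bar>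
      \<le> \<epsilon> * (norm y)\<^sup>2 + M * norm x powr - q\<^sub>0 * (norm y * \<bar>\<tau>\<bar>) + \<epsilon> * norm x powr - q' * \<tau>\<^sup>2"
proof -
  obtain K where K: "K > 0" "\<forall>\<^sub>F x in at_infinity. x \<noteq> 0 \<and> fall_off_bound K x"
    using eventually_fall_off_bound by blast
  define e where "e x = K * norm x powr - p\<^sub>0" for x :: "real^'n"
  define w where "w x = K * norm x powr - q\<^sub>0" for x :: "real^'n"
  define s where "s x = K * norm x powr - q'" for x :: "real^'n"
  have lim: "(e \<longlongrightarrow> 0) at_infinity" "(w \<longlongrightarrow> 0) at_infinity" "(s \<longlongrightarrow> 0) at_infinity"
    unfolding e_def[abs_def] w_def[abs_def] s_def[abs_def]
    using tendsto_norm_powr_neg[where 'b = "real^'n"] pos by (auto intro!: tendsto_mult_right_zero)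
  have "((\<lambda>x. 6 * e x + 8 * (w x)\<^sup>2) \<longlongrightarrow> 0) at_infinity"
    "((\<lambda>x. 2 * K * (e x + 2 * (w x)\<^sup>2)) \<longlongrightarrow> 0) at_infinity"
    by (auto intro!: tendsto_eq_intros lim)
  then have "\<forall>\<^sub>F x in at_infinity. 6 * e x + 8 * (w x)\<^sup>2 < \<epsilon>"
    "\<forall>\<^sub>F x in at_infinity. 2 * K * (e x + 2 * (w x)\<^sup>2) < \<epsilon>"
    using \<epsilon> by (auto dest: order_tendstoD)
  moreover have "\<forall>\<^sub>F x in at_infinity. e x < 1 / 2" "\<forall>\<^sub>F x in at_infinity. s x < 1 / 2"
    using order_tendstoD(2)[OF lim(1), of "1 / 2"] order_tendstoD(2)[OF lim(3), of "1 / 2"] by simp_all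
  ultimately have "\<forall>\<^sub>F x in at_infinity. \<forall>r\<^sub>0 t y \<tau>.
    \<bar>hessian metric (cylinder_fun r\<^sub>0) (x, t) (y, \<tau>) (y, \<tau>) + 2 * (norm y)\<^sup>2 - DB x x * \<tau>\<^sup>2\<bar>
      \<le> \<epsilon> * (norm y)\<^sup>2 + 16 * K * norm x powr - q\<^sub>0 * (norm y * \<bar>\<tau>\<bar>) + \<epsilon> * norm x powr - q' * \<tau>\<^sup>2"
    using K(2)
  proof eventually_elim
    case (elim x)
    have x: "x \<in> U" "x \<noteq> 0" and fb: "fall_off_bound K x" using elim(5) in_U by auto
    have nn: "0 \<le> e x" "0 \<le> w x" "0 \<le> s x" using K by (simp_all add: e_def w_def s_def)
    have B: "B x \<ge> 1 / 2"
      using fb elim(4) by (auto simp: fall_off_bound_def s_def abs_le_iff)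
    show ?case
    proof (intro allI)
      fix r\<^sub>0 t y \<tau>
      have "\<bar>hessian metric (cylinder_fun r\<^sub>0) (x, t) (y, \<tau>) (y, \<tau>) + 2 * (norm y)\<^sup>2 - DB x x * \<tau>\<^sup>2\<bar>
        \<le> (6 * e x + 8 * (w x)\<^sup>2) * (norm y)\<^sup>2 + 8 * w x * (1 + s x) * (norm y * \<bar>\<tau>\<bar>)
          + 2 * s x * (e x + 2 * (w x)\<^sup>2) * \<tau>\<^sup>2"
        by (rule hessian_estimate[OF cylinder_fun_def x _ _ _ _ _ B _ nn])
          (use fb elim(3) in \<open>simp_all add: fall_off_bound_def e_def w_def s_def\<close>)
      also have "\<dots> \<le> \<epsilon> * (norm y)\<^sup>2 + 16 * K * norm x powr - q\<^sub>0 * (norm y * \<bar>\<tau>\<bar>)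
          + \<epsilon> * norm x powr - q' * \<tau>\<^sup>2"
      proof (intro add_mono mult_right_mono)
        have "8 * w x * (1 + s x) \<le> 8 * w x * 2" using elim(4) nn by (intro mult_left_mono) auto
        then show "8 * w x * (1 + s x) \<le> 16 * K * norm x powr - q\<^sub>0" by (simp add: w_def)
        have "2 * K * (e x + 2 * (w x)\<^sup>2) * norm x powr - q' \<le> \<epsilon> * norm x powr - q'"
          using elim(2) by (intro mult_right_mono) auto
        then show "2 * s x * (e x + 2 * (w x)\<^sup>2) \<le> \<epsilon> * norm x powr - q'"
          by (simp add: s_def algebra_simps)
      qed (use elim(1) in auto)
      finally show "\<bar>hessian metric (cylinder_fun r\<^sub>0) (x, t) (y, \<tau>) (y, \<tau>) + 2 * (norm y)\<^sup>2
          - DB x x * \<tau>\<^sup>2\<bar> \<le> \<dots>" .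
    qed
  qed
  then show ?thesis by blast
qed

text \<open>Far out the metric is close to the Minkowski metric, so the time component of a lightlike
  vector is controlled by its space component.\<close>

lemma eventually_lightlike_bound:
  "\<forall>\<^sub>F x in at_infinity. \<forall>t y \<tau>. metric (x, t) (y, \<tau>) (y, \<tau>) = 0 \<longrightarrow> \<bar>\<tau>\<bar> \<le> 3 * norm y"
proof -
  obtain K where K: "K > 0" "\<forall>\<^sub>F x in at_infinity. x \<noteq> 0 \<and> fall_off_bound K x"
    using eventually_fall_off_bound by blast
  have "\<forall>\<^sub>F x::real^'n in at_infinity. K * norm x powr - p\<^sub>0 < 1 / 2"
    "\<forall>\<^sub>F x::real^'n in at_infinity. K * norm x powr - q\<^sub>0 < 1 / 8"
    "\<forall>\<^sub>F x::real^'n in at_infinity. K * norm x powr - q' < 1 / 2"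
    by (intro eventually_norm_powr_neg_less pos; simp)+
  with K(2) show ?thesis
  proof eventually_elim
    case (elim x)
    have fb: "fall_off_bound K x" using elim(1) by blast
    show ?case
    proof (intro allI impI)
      fix t y \<tau> assume "metric (x, t) (y, \<tau>) (y, \<tau>) = 0"
      then have eq: "B x * (\<bar>\<tau>\<bar> * \<bar>\<tau>\<bar>) = G x y y + 2 * (W x y * \<tau>)"
        by (simp add: metric_eq algebra_simps)
      have "\<bar>G x y y - y \<bullet> y\<bar> \<le> K * norm x powr - p\<^sub>0 * norm y * norm y"
        using fb by (simp add: fall_off_bound_def)
      also have "\<dots> \<le> 1 / 2 * norm y * norm y"
        using elim(2) by (intro mult_right_mono) auto
      finally have 1: "G x y y \<le> 3 / 2 * (norm y * norm y)"
        unfolding dot_square_norm power2_eq_square abs_le_iff by simp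
      have "\<bar>W x y\<bar> \<le> K * norm x powr - q\<^sub>0 * norm y" using fb by (simp add: fall_off_bound_def)
      also have "\<dots> \<le> 1 / 8 * norm y" using elim(3) by (intro mult_right_mono) auto
      finally have "\<bar>W x y * \<tau>\<bar> \<le> 1 / 8 * norm y * \<bar>\<tau>\<bar>"
        unfolding abs_mult by (intro mult_right_mono) auto
      then have 2: "W x y * \<tau> \<le> 1 / 8 * (norm y * \<bar>\<tau>\<bar>)" by simp
      have "B x \<ge> 1 / 2" using fb elim(4) by (auto simp: fall_off_bound_def abs_le_iff)
      then have 3: "1 / 2 * (\<bar>\<tau>\<bar> * \<bar>\<tau>\<bar>) \<le> B x * (\<bar>\<tau>\<bar> * \<bar>\<tau>\<bar>)" by (intro mult_right_mono) auto
      show "\<bar>\<tau>\<bar> \<le> 3 * norm y"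
      proof (rule ccontr)
        assume "\<not> \<bar>\<tau>\<bar> \<le> 3 * norm y"
        then have lt: "norm y \<le> \<bar>\<tau>\<bar> / 3" "\<bar>\<tau>\<bar> > 0" by auto
        have "norm y * norm y \<le> \<bar>\<tau>\<bar> / 3 * (\<bar>\<tau>\<bar> / 3)" "norm y * \<bar>\<tau>\<bar> \<le> \<bar>\<tau>\<bar> / 3 * \<bar>\<tau>\<bar>"
          using lt by (intro mult_mono; simp)+
        moreover have "\<bar>\<tau>\<bar> * \<bar>\<tau>\<bar> > 0" using lt(2) mult_pos_pos by blast
        ultimately show False using eq 1 2 3 by (simp del: abs_mult_self_eq)
      qed
    qed
  qed
qed

end

section \<open>Convexity of large cylinders\<close>

lemma quadratic_form_neg:
  fixes a b m k :: real
  assumes "m\<^sup>2 < 6 * k" "a \<noteq> 0 \<or> b \<noteq> 0"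
  shows "- 3 / 2 * a\<^sup>2 + m * (a * b) - k * b\<^sup>2 < 0"
proof -
  define T where "T = - 3 / 2 * a\<^sup>2 + m * (a * b) - k * b\<^sup>2"
  have "6 * T = - (3 * a - m * b)\<^sup>2 - (6 * k - m\<^sup>2) * b\<^sup>2"
    by (simp add: T_def power2_eq_square algebra_simps)
  also have "\<dots> < 0"
  proof (cases "b = 0")
    case False
    then have "(6 * k - m\<^sup>2) * b\<^sup>2 > 0" using assms by simp
    then show ?thesis using zero_le_power2[of "3 * a - m * b"] by linarith
  qed (use assms in simp)
  finally have "T < 0" by simp
  then show ?thesis by (simp only: T_def)
qed

lemma time_direction_tangent_cylinder:
  assumes "norm x = r"
  shows "(0, 1) \<in> tangent_vectors (cylinder r) (x, t)"
  unfolding tangent_vectors_def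
proof (intro CollectI exI conjI)
  show "((\<lambda>s. (x, t + s)) has_vector_derivative (0, 1)) (at 0)"
    by (auto intro!: derivative_eq_intros has_vector_derivative_Pair)
qed (use assms in \<open>auto simp: cylinder_def\<close>)

context asymptotic_end
begin

text \<open>The Hessian is negative on every nonzero vector, tangent to the cylinder or not.\<close>

theorem eventually_strongly_time_convex:
  assumes C: "C > 0" and q: "q' < 2 * q\<^sub>0"
    and equiv: "radial_deriv B \<sim>[at_infinity] (\<lambda>x. - C / norm x powr (q' + 1))"
  shows "\<forall>\<^sub>F r\<^sub>0 in at_top. strongly_time_convex metric (cylinder_fun r\<^sub>0) (cylinder r\<^sub>0)"
proof -
  define \<epsilon> where "\<epsilon> = min (1 / 2) (C / 4)"
  have \<epsilon>: "\<epsilon> > 0" "\<epsilon> \<le> 1 / 2" "\<epsilon> \<le> C / 4" using C by (auto simp: \<epsilon>_def)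
  obtain M where M: "\<forall>\<^sub>F x in at_infinity. \<forall>r\<^sub>0 t y \<tau>.
    \<bar>hessian metric (cylinder_fun r\<^sub>0) (x, t) (y, \<tau>) (y, \<tau>) + 2 * (norm y)\<^sup>2 - DB x x * \<tau>\<^sup>2\<bar>
      \<le> \<epsilon> * (norm y)\<^sup>2 + M * norm x powr - q\<^sub>0 * (norm y * \<bar>\<tau>\<bar>) + \<epsilon> * norm x powr - q' * \<tau>\<^sup>2"
    using hessian_asymptotics[OF \<epsilon>(1)] by blast
  have "(\<lambda>x. - radial_deriv B x) \<sim>[at_infinity] (\<lambda>x. C / norm x powr (q' + 1))"
    using asymp_equiv_uminus[OF equiv] by simp
  then have D: "\<forall>\<^sub>F x in at_infinity. norm x * - radial_deriv B x \<ge> 3 / 4 * C * norm x powr - q'"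
    by (rule asymp_equiv_powr_lower_bound[OF _ C])
  have "\<forall>\<^sub>F x::real^'n in at_infinity. M\<^sup>2 * norm x powr - (2 * q\<^sub>0 - q') < 3 * C"
    using q C by (intro eventually_norm_powr_neg_less) auto
  moreover have "\<forall>\<^sub>F x::real^'n in at_infinity. norm x \<ge> 1" by (auto simp: eventually_at_infinity)
  ultimately have "\<forall>\<^sub>F x in at_infinity. \<forall>r\<^sub>0 t y \<tau>. y \<noteq> 0 \<or> \<tau> \<noteq> 0 \<longrightarrow>
      hessian metric (cylinder_fun r\<^sub>0) (x, t) (y, \<tau>) (y, \<tau>) < 0"
    using M D
  proof eventually_elim
    case (elim x)
    define \<sigma> where "\<sigma> = norm x powr - q'"
    define m where "m = M * norm x powr - q\<^sub>0"
    have x: "x \<noteq> 0" using elim(2) by auto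
    then have \<sigma>: "\<sigma> > 0" by (simp add: \<sigma>_def)
    \<comment> \<open>Since \<open>q' < 2 * q\<^sub>0\<close>, the square of the mixed coefficient is of smaller order than the
      product of the diagonal coefficients.\<close>
    have "m\<^sup>2 = M\<^sup>2 * norm x powr - (2 * q\<^sub>0 - q') * \<sigma>"
      by (simp add: m_def \<sigma>_def power_mult_distrib power2_eq_square powr_add[symmetric])
    also have "\<dots> < 3 * C * \<sigma>" using elim(1) \<sigma> by (rule mult_strict_right_mono)
    finally have m: "m\<^sup>2 < 6 * (C / 2 * \<sigma>)" by simp
    have DB: "DB x x \<le> - (3 / 4 * C * \<sigma>)"
      using elim(4) DB_radial[OF x] by (simp add: \<sigma>_def)
    show ?case
    proof (intro allI impI)
      fix r\<^sub>0 t \<tau> :: real and y :: "real^'n" assume y: "y \<noteq> 0 \<or> \<tau> \<noteq> 0"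
      have "hessian metric (cylinder_fun r\<^sub>0) (x, t) (y, \<tau>) (y, \<tau>)
          \<le> - 2 * (norm y)\<^sup>2 + DB x x * \<tau>\<^sup>2 + \<epsilon> * (norm y)\<^sup>2 + m * (norm y * \<bar>\<tau>\<bar>) + \<epsilon> * \<sigma> * \<tau>\<^sup>2"
        using elim(3)[rule_format, of r\<^sub>0 t y \<tau>] unfolding m_def \<sigma>_def abs_le_iff by linarith
      also have "\<dots> \<le> - 2 * (norm y)\<^sup>2 + - (3 / 4 * C * \<sigma>) * \<tau>\<^sup>2 + 1 / 2 * (norm y)\<^sup>2
          + m * (norm y * \<bar>\<tau>\<bar>) + C / 4 * \<sigma> * \<tau>\<^sup>2"
        using \<epsilon> \<sigma> by (intro add_mono mult_right_mono DB order_refl) auto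
      also have "\<dots> = - 3 / 2 * (norm y)\<^sup>2 + m * (norm y * \<bar>\<tau>\<bar>) - C / 2 * \<sigma> * \<bar>\<tau>\<bar>\<^sup>2"
        by (simp add: algebra_simps)
      also have "\<dots> < 0" using y by (intro quadratic_form_neg[OF m]) auto
      finally show "hessian metric (cylinder_fun r\<^sub>0) (x, t) (y, \<tau>) (y, \<tau>) < 0" .
    qed
  qed
  from eventually_sphere[OF this] show ?thesis
  proof eventually_elim
    case (elim r\<^sub>0)
    show ?case
      unfolding strongly_time_convex_def
    proof (intro ballI impI)
      fix z v assume z: "z \<in> cylinder r\<^sub>0" and "timelike metric z v"
      obtain x t y \<tau> where zv: "z = (x, t)" "v = (y, \<tau>)" by fastforce
      have x: "norm x = r\<^sub>0" using z by (simp add: zv cylinder_def)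
      then have "x \<in> U" using elim in_U[of x] by auto
      then have "v \<noteq> 0"
        using \<open>timelike metric z v\<close> bilinear_lzero[OF bilinear_metric, of x t v]
        by (auto simp: timelike_def zv)
      then show "hessian metric (cylinder_fun r\<^sub>0) z v v < 0"
        using elim x by (simp add: zv zero_prod_def)
    qed
  qed
qed

text \<open>On lightlike vectors all terms are dominated by \<open>- |y|\<^sup>2\<close>, whatever the behaviour of
  \<open>\<partial>\<^sub>r \<beta>\<close>.\<close>

theorem eventually_strongly_light_convex:
  "\<forall>\<^sub>F r\<^sub>0 in at_top. strongly_light_convex metric (cylinder_fun r\<^sub>0) (cylinder r\<^sub>0)"
proof -
  obtain M where M: "\<forall>\<^sub>F x in at_infinity. \<forall>r\<^sub>0 t y \<tau>.
    \<bar>hessian metric (cylinder_fun r\<^sub>0) (x, t) (y, \<tau>) (y, \<tau>) + 2 * (norm y)\<^sup>2 - DB x x * \<tau>\<^sup>2\<bar>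
      \<le> 1 * (norm y)\<^sup>2 + M * norm x powr - q\<^sub>0 * (norm y * \<bar>\<tau>\<bar>) + 1 * norm x powr - q' * \<tau>\<^sup>2"
    using hessian_asymptotics[of 1] by auto
  obtain K where K: "K > 0" "\<forall>\<^sub>F x in at_infinity. x \<noteq> 0 \<and> fall_off_bound K x"
    using eventually_fall_off_bound by blast
  have "((\<lambda>x::real^'n. 3 * (\<bar>M\<bar> * norm x powr - q\<^sub>0) + 9 * ((K + 1) * norm x powr - q')) \<longlongrightarrow> 3 * (\<bar>M\<bar> * 0) + 9 * ((K + 1) * 0)) at_infinity"
    using pos by (intro tendsto_intros tendsto_norm_powr_neg)
  then have "\<forall>\<^sub>F x::real^'n in at_infinity.
      3 * (\<bar>M\<bar> * norm x powr - q\<^sub>0) + 9 * ((K + 1) * norm x powr - q') < 1"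
    by (rule order_tendstoD) simp
  with M K(2) eventually_lightlike_bound
  have "\<forall>\<^sub>F x in at_infinity. \<forall>r\<^sub>0 t y \<tau>. metric (x, t) (y, \<tau>) (y, \<tau>) = 0 \<and> (y \<noteq> 0 \<or> \<tau> \<noteq> 0) \<longrightarrow>
      hessian metric (cylinder_fun r\<^sub>0) (x, t) (y, \<tau>) (y, \<tau>) < 0"
  proof eventually_elim
    case (elim x)
    define \<sigma> where "\<sigma> = norm x powr - q'"
    define m where "m = norm x powr - q\<^sub>0"
    have nn: "\<sigma> \<ge> 0" "m \<ge> 0" by (simp_all add: \<sigma>_def m_def)
    have "norm x * DB x x \<le> norm x * \<bar>DB x x\<bar>" by (simp add: mult_left_mono)
    also have "\<dots> \<le> K * \<sigma> * norm x" using elim(2) by (simp add: fall_off_bound_def \<sigma>_def)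
    finally have "norm x * DB x x \<le> norm x * (K * \<sigma>)" by (simp add: mult_ac)
    then have DB: "DB x x \<le> K * \<sigma>" using elim(2) by simp
    show ?case
    proof (intro allI impI, elim conjE)
      fix r\<^sub>0 t \<tau> :: real and y :: "real^'n"
      assume light: "metric (x, t) (y, \<tau>) (y, \<tau>) = 0" and nz: "y \<noteq> 0 \<or> \<tau> \<noteq> 0"
      have \<tau>: "\<bar>\<tau>\<bar> \<le> 3 * norm y" using elim(3) light by blast
      then have y: "(norm y)\<^sup>2 > 0" using nz by auto
      have \<tau>2: "\<tau>\<^sup>2 \<le> 9 * (norm y)\<^sup>2" using power_mono[OF \<tau>, of 2] by (simp add: power_mult_distrib)
      have y\<tau>: "norm y * \<bar>\<tau>\<bar> \<le> 3 * (norm y)\<^sup>2"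
        using mult_left_mono[OF \<tau> norm_ge_zero[of y]] by (simp add: power2_eq_square mult_ac)
      have "hessian metric (cylinder_fun r\<^sub>0) (x, t) (y, \<tau>) (y, \<tau>)
          \<le> - (norm y)\<^sup>2 + DB x x * \<tau>\<^sup>2 + M * m * (norm y * \<bar>\<tau>\<bar>) + \<sigma> * \<tau>\<^sup>2"
        using elim(1)[rule_format, of r\<^sub>0 t y \<tau>] unfolding m_def \<sigma>_def abs_le_iff by linarith
      also have "\<dots> \<le> - (norm y)\<^sup>2 + K * \<sigma> * \<tau>\<^sup>2 + \<bar>M\<bar> * m * (norm y * \<bar>\<tau>\<bar>) + \<sigma> * \<tau>\<^sup>2"
        using nn by (intro add_mono mult_right_mono DB order_refl) auto
      also have "\<dots> = - (norm y)\<^sup>2 + (K + 1) * \<sigma> * \<tau>\<^sup>2 + \<bar>M\<bar> * m * (norm y * \<bar>\<tau>\<bar>)"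
        by (simp add: algebra_simps)
      also have "\<dots> \<le> - (norm y)\<^sup>2 + (K + 1) * \<sigma> * (9 * (norm y)\<^sup>2) + \<bar>M\<bar> * m * (3 * (norm y)\<^sup>2)"
        using nn K by (intro add_mono mult_left_mono \<tau>2 y\<tau> order_refl) auto
      also have "\<dots> = (3 * (\<bar>M\<bar> * m) + 9 * ((K + 1) * \<sigma>) - 1) * (norm y)\<^sup>2"
        by (simp add: algebra_simps)
      also have "\<dots> < 0" using elim(4) y by (intro mult_neg_pos) (simp_all add: m_def \<sigma>_def)
      finally show "hessian metric (cylinder_fun r\<^sub>0) (x, t) (y, \<tau>) (y, \<tau>) < 0" .
    qed
  qed
  from eventually_sphere[OF this] show ?thesis
  proof eventually_elim
    case (elim r\<^sub>0)
    show ?case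
      unfolding strongly_light_convex_def
    proof (intro ballI impI)
      fix z v assume z: "z \<in> cylinder r\<^sub>0" and v: "lightlike metric z v"
      obtain x t y \<tau> where zv: "z = (x, t)" "v = (y, \<tau>)" by fastforce
      have "norm x = r\<^sub>0" using z by (simp add: zv cylinder_def)
      moreover have "metric (x, t) (y, \<tau>) (y, \<tau>) = 0" "y \<noteq> 0 \<or> \<tau> \<noteq> 0"
        using v by (auto simp: zv lightlike_def zero_prod_def)
      ultimately show "hessian metric (cylinder_fun r\<^sub>0) z v v < 0"
        using elim unfolding zv by blast
    qed
  qed
qed

text \<open>The witness is the tangent vector \<open>(0, 1)\<close>: it is timelike and the Hessian on it is
  \<open>|x| \<partial>\<^sub>r \<beta>\<close> up to an error of at most a third of it.\<close>

theorem eventually_not_infinitesimally_time_convex: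
  assumes C: "C > 0"
    and equiv: "radial_deriv B \<sim>[at_infinity] (\<lambda>x. C / norm x powr (q' + 1))"
  shows "\<forall>\<^sub>F r\<^sub>0 in at_top. \<not> infinitesimally_time_convex metric (cylinder_fun r\<^sub>0) (cylinder r\<^sub>0)"
proof -
  obtain M where "\<forall>\<^sub>F x in at_infinity. \<forall>r\<^sub>0 t y \<tau>.
    \<bar>hessian metric (cylinder_fun r\<^sub>0) (x, t) (y, \<tau>) (y, \<tau>) + 2 * (norm y)\<^sup>2 - DB x x * \<tau>\<^sup>2\<bar>
      \<le> C / 4 * (norm y)\<^sup>2 + M * norm x powr - q\<^sub>0 * (norm y * \<bar>\<tau>\<bar>) + C / 4 * norm x powr - q' * \<tau>\<^sup>2"
    using hessian_asymptotics[of "C / 4"] C by auto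
  moreover have "\<forall>\<^sub>F x::real^'n in at_infinity. norm x \<ge> 1" by (auto simp: eventually_at_infinity)
  ultimately have "\<forall>\<^sub>F x in at_infinity. \<forall>r\<^sub>0 t.
      hessian metric (cylinder_fun r\<^sub>0) (x, t) (0, 1) (0, 1) > 0"
    using asymp_equiv_powr_lower_bound[OF equiv C]
  proof eventually_elim
    case (elim x)
    have "x \<noteq> 0" using elim(2) by auto
    then have "DB x x \<ge> 3 / 4 * C * norm x powr - q'" and "C * norm x powr - q' > 0"
      using elim(3) C DB_radial[of x] by auto
    moreover have "\<bar>hessian metric (cylinder_fun r\<^sub>0) (x, t) (0, 1) (0, 1) - DB x x\<bar>
        \<le> 1 / 4 * (C * norm x powr - q')" for r\<^sub>0 t
      using elim(1)[rule_format, of r\<^sub>0 t 0 1] by simp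
    ultimately show ?case
    proof (intro allI)
      fix r\<^sub>0 t
      assume "DB x x \<ge> 3 / 4 * C * norm x powr - q'" "C * norm x powr - q' > 0"
        and "\<And>r\<^sub>0 t. \<bar>hessian metric (cylinder_fun r\<^sub>0) (x, t) (0, 1) (0, 1) - DB x x\<bar>
          \<le> 1 / 4 * (C * norm x powr - q')"
      from this(1,2) this(3)[of r\<^sub>0 t]
      show "hessian metric (cylinder_fun r\<^sub>0) (x, t) (0, 1) (0, 1) > 0"
        unfolding abs_le_iff by linarith
    qed
  qed
  from eventually_sphere[OF this] show ?thesis
  proof eventually_elim
    case (elim r\<^sub>0)
    obtain x :: "real^'n" where x: "norm x = r\<^sub>0" using elim vector_choose_size[of r\<^sub>0] by auto
    then have "x \<in> U" using elim in_U[of x] by auto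
    then have "timelike metric (x, 0) (0, 1)"
      using pos_B[of x] by (simp add: timelike_def metric_eq bilinear_lzero[OF bilinear_G]
          linear_0[OF linear_W])
    moreover have "(x, 0) \<in> cylinder r\<^sub>0" using x by (simp add: cylinder_def)
    moreover have "(0, 1) \<in> tangent_vectors (cylinder r\<^sub>0) (x, 0)"
      using x by (rule time_direction_tangent_cylinder)
    moreover have "hessian metric (cylinder_fun r\<^sub>0) (x, 0) (0, 1) (0, 1) > 0" using elim x by blast
    ultimately show ?case unfolding infinitesimally_time_convex_def by force
  qed
qed

end

theorem corollary4p7:
  fixes S :: "'a topology" and A :: "('a, real^'n) chart set"
    and g\<^sub>0 :: "('a, real^'n) chart \<Rightarrow> real^'n \<Rightarrow> real^'n \<Rightarrow> real^'n \<Rightarrow> real"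
    and \<omega>\<^sub>0 :: "('a, real^'n) chart \<Rightarrow> real^'n \<Rightarrow> real^'n \<Rightarrow> real"
    and \<beta> :: "'a \<Rightarrow> real"
    and K :: "'a set" and EE :: "('a, real^'n) chart set" and E :: "('a, real^'n) chart"
    and p\<^sub>0 q\<^sub>0 q' C :: real
  assumes "standard_stationary S A g\<^sub>0 \<omega>\<^sub>0 \<beta>"
    and "asymptotic_ends S A K EE"
    and "p\<^sub>0 > 0" and "q\<^sub>0 > 0" and "q' > 0"
    and "\<forall>c\<in>EE. fall_off g\<^sub>0 \<omega>\<^sub>0 \<beta> p\<^sub>0 q\<^sub>0 q' c"
    and "C > 0" and "E \<in> EE"
  shows "(q' \<in> {0<..<2 * q\<^sub>0} \<and>
           (radial_deriv (\<beta> \<circ> chart_inv E)) \<sim>[at_infinity] (\<lambda>x. - C / norm x powr (q' + 1)) \<longrightarrow>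
           (\<forall>\<^sub>F r\<^sub>0 in at_top. strongly_time_convex
                (stationary_metric g\<^sub>0 \<omega>\<^sub>0 \<beta> E) (cylinder_fun r\<^sub>0) (cylinder r\<^sub>0)))
       \<and> ((radial_deriv (\<beta> \<circ> chart_inv E)) \<sim>[at_infinity] (\<lambda>x. C / norm x powr (q' + 1)) \<longrightarrow>
           (\<forall>\<^sub>F r\<^sub>0 in at_top. strongly_light_convex
                (stationary_metric g\<^sub>0 \<omega>\<^sub>0 \<beta> E) (cylinder_fun r\<^sub>0) (cylinder r\<^sub>0) \<and>
              \<not> infinitesimally_time_convex
                (stationary_metric g\<^sub>0 \<omega>\<^sub>0 \<beta> E) (cylinder_fun r\<^sub>0) (cylinder r\<^sub>0)))"
proof -
  have "E \<in> A" and image: "chart_image E = UNIV - {0}"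
    using assms(2,8) by (auto simp: asymptotic_ends_def)
  interpret asymptotic_end S A g\<^sub>0 \<omega>\<^sub>0 \<beta> E p\<^sub>0 q\<^sub>0 q'
    by unfold_locales (use assms \<open>E \<in> A\<close> image in auto)
  show ?thesis
    using eventually_strongly_time_convex[OF \<open>C > 0\<close>] eventually_strongly_light_convex
      eventually_not_infinitesimally_time_convex[OF \<open>C > 0\<close>]
    by (auto intro: eventually_conj)
qed

end
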